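(* Suppose $\vec h=\vec0$ and $\xi(x_1,\dots,x_r)=\prod_{s\in\mathscr S}x_s^{a_s}$ for positive integers $a_1,\dots,a_r$ with $r\ge2$ and $\sum_{s\in\mathscr S}a_s\ge3$. Define exponents $$b_s=\frac{1-\sqrt{\frac{a_s}{a_s+L\lambda_s}}}{2},\qquad s\in\mathscr S,$$ where $L=L(\vec a)>0$ is the unique value such that $\sum_{s\in\mathscr S}a_sb_s=1$. Then $\mathsf{ALG}$ and the $(p,\Phi,q_0)$ maximizing $\mathbb A$ are $$\mathsf{ALG}=\sum_{s\in\mathscr S}\frac{\lambda_s\sqrt{La_s}}{\sqrt{a_s+L\lambda_s}},\qquad(p(q),\Phi(q),q_0)=\big(1,(q^{b_1},\dots,q^{b_r}),0\big).$$ In the case $\xi(x_1,x_2)=x_1x_2$ (with $r=2$, $\vec h=\vec0$) we have $$\mathsf{ALG}=\sqrt{\lambda_1}+\sqrt{\lambda_2},\qquad(p(q),\Phi(q),q_0)=\big(1,(q,q),0\big).$$ Moreover the optimal $(p,\Phi,q_0)$ is always unique up to reparametrization.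
   Context: Here $\mathscr S=\{1,\dots,r\}$, $\vec\lambda\in\mathbb R_{>0}^{\mathscr S}$ with $\sum_s\lambda_s=1$, and $\xi^s(\vec x)=\lambda_s^{-1}\partial_{x_s}\xi(\vec x)$. For $0\le q_0\le1$, $\mathbb I(q_0,1)$ is the set of increasing (i.e. nondecreasing), continuously differentiable functions $[q_0,1]\to[0,1]$, and $\mathrm{Adm}(q_0,1)$ is the set of $\Phi=(\Phi_s)_s\in\mathbb I(q_0,1)^{\mathscr S}$ with $\sum_s\lambda_s\Phi_s(q)=q$ for all $q$ (admissibility). With $(p\times\xi^s\circ\Phi)(q)=p(q)\xi^s(\Phi(q))$ and $\vec h=(h_s)_s$, $$\mathbb A(p,\Phi;q_0)=\sum_{s}\lambda_s\Big[h_s\sqrt{\Phi_s(q_0)}+\int_{q_0}^1\sqrt{\Phi_s'(q)(p\times\xi^s\circ\Phi)'(q)}\,dq\Big],\qquad\mathsf{ALG}=\sup_{q_0\in[0,1]}\sup_{p\in\mathbb I(q_0,1),\,\Phi\in\mathrm{Adm}(q_0,1)}\mathbb A(p,\Phi;q_0).$$ The paths $\Phi$ displayed in the theorem need not be admissible: admissibility is only a choice of time parametrization. $\mathbb A(p,\Phi;q_0)$ is evaluated by the same formula for non-admissible paths and is unchanged when $(p,\Phi,q_0)$ is replaced by a reparametrization $(p\circ\alpha,\Phi\circ\alpha,\alpha^{-1}(q_0))$ with $\alpha$ an increasing change of time variable; the displayed maximizer, and the uniqueness, are understood up to such reparametrization. *)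

theory Defs
  imports "HOL-Analysis.Analysis"
begin

text \<open>
  Species are indexed by a finite type \<open>'s\<close>. Paths are functions on all of \<open>real\<close>, of which
  only the values on \<open>[q0, 1]\<close> matter; this is why continuous
  differentiability is expressed with derivatives within \<open>[q0, 1]\<close>.
\<close>

definition incr_paths :: "real \<Rightarrow> (real \<Rightarrow> real) set" where
  "incr_paths q0 = {f. f ` {q0..1} \<subseteq> {0..1} \<and> mono_on {q0..1} f \<and>
     (\<exists>f'. continuous_on {q0..1} f' \<and>
       (\<forall>q\<in>{q0..1}. (f has_real_derivative f' q) (at q within {q0..1})))}"

definition Adm :: "real ^ 's \<Rightarrow> real \<Rightarrow> (real \<Rightarrow> real ^ 's::finite) set" where
  "Adm lam q0 = {\<Phi>. (\<forall>s. (\<lambda>q. \<Phi> q $ s) \<in> incr_paths q0) \<and>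
     (\<forall>q\<in>{q0..1}. (\<Sum>s\<in>UNIV. lam $ s * \<Phi> q $ s) = q)}"

definition xi_species :: "real ^ 's \<Rightarrow> (real ^ 's \<Rightarrow> real) \<Rightarrow> 's \<Rightarrow> real ^ 's::finite \<Rightarrow> real" where
  "xi_species lam \<xi> s x = deriv (\<lambda>t. \<xi> (x + t *\<^sub>R axis s 1)) 0 / lam $ s"

text \<open>
  The formula makes sense for non-admissible paths as well. Two-sided derivatives are used in the
  integrand: they can differ from the one-sided ones only at the two endpoints, which are
  negligible for the integral.
\<close>

definition alg_functional ::
  "real ^ 's \<Rightarrow> (real ^ 's \<Rightarrow> real) \<Rightarrow> real ^ 's \<Rightarrow>
    (real \<Rightarrow> real) \<Rightarrow> (real \<Rightarrow> real ^ 's::finite) \<Rightarrow> real \<Rightarrow> real" where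
  "alg_functional lam \<xi> h p \<Phi> q0 =
     (\<Sum>s\<in>UNIV. lam $ s * (h $ s * sqrt (\<Phi> q0 $ s) +
        integral {q0..1} (\<lambda>q. sqrt (deriv (\<lambda>t. \<Phi> t $ s) q *
                                   deriv (\<lambda>t. p t * xi_species lam \<xi> s (\<Phi> t)) q))))"

text \<open>
  The supremum is taken in the extended reals, so that stating a real value for it includes the
  claim that the functional is bounded above.
\<close>

definition ALG :: "real ^ 's \<Rightarrow> (real ^ 's \<Rightarrow> real) \<Rightarrow> real ^ 's::finite \<Rightarrow> ereal" where
  "ALG lam \<xi> h = (SUP q0\<in>{0..1}. SUP p\<in>incr_paths q0. SUP \<Phi>\<in>Adm lam q0.
     ereal (alg_functional lam \<xi> h p \<Phi> q0))"

definition feasible ::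
  "real ^ 's \<Rightarrow> (real \<Rightarrow> real) \<Rightarrow> (real \<Rightarrow> real ^ 's::finite) \<Rightarrow> real \<Rightarrow> bool" where
  "feasible lam p \<Phi> q0 \<longleftrightarrow> q0 \<in> {0..1} \<and> p \<in> incr_paths q0 \<and> \<Phi> \<in> Adm lam q0"

definition maximizer ::
  "real ^ 's \<Rightarrow> (real ^ 's \<Rightarrow> real) \<Rightarrow> real ^ 's \<Rightarrow>
    (real \<Rightarrow> real) \<Rightarrow> (real \<Rightarrow> real ^ 's::finite) \<Rightarrow> real \<Rightarrow> bool" where
  "maximizer lam \<xi> h p \<Phi> q0 \<longleftrightarrow>
     feasible lam p \<Phi> q0 \<and> ereal (alg_functional lam \<xi> h p \<Phi> q0) = ALG lam \<xi> h"

text \<open>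
  An increasing change of time variable from \<open>[u, 1]\<close> onto \<open>[v, 1]\<close>: a homeomorphism (continuity
  follows from monotonicity and surjectivity) that is a diffeomorphism of the open intervals.
  Nothing is required of the derivative at the endpoints, since passing from \<open>q powr b\<close> with
  \<open>b < 1\<close> to an admissible path needs a time change whose inverse has infinite slope at \<open>0\<close>.
\<close>

definition time_change :: "real \<Rightarrow> real \<Rightarrow> (real \<Rightarrow> real) \<Rightarrow> bool" where
  "time_change u v \<alpha> \<longleftrightarrow> strict_mono_on {u..1} \<alpha> \<and> \<alpha> ` {u..1} = {v..1} \<and>
     (\<exists>\<alpha>'. continuous_on {u<..<1} \<alpha>' \<and>
       (\<forall>t\<in>{u<..<1}. 0 < \<alpha>' t \<and> (\<alpha> has_real_derivative \<alpha>' t) (at t)))"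

text \<open>\<open>(p', \<Phi>', q0') = (p \<circ> \<alpha>, \<Phi> \<circ> \<alpha>, \<alpha>\<^sup>-\<^sup>1 q0)\<close> for some time change \<open>\<alpha>\<close>.\<close>

definition reparametrization ::
  "(real \<Rightarrow> real) \<Rightarrow> (real \<Rightarrow> real ^ 's::finite) \<Rightarrow> real \<Rightarrow>
   (real \<Rightarrow> real) \<Rightarrow> (real \<Rightarrow> real ^ 's) \<Rightarrow> real \<Rightarrow> bool" where
  "reparametrization p \<Phi> q0 p' \<Phi>' q0' \<longleftrightarrow>
     (\<exists>\<alpha>. time_change q0' q0 \<alpha> \<and> (\<forall>t\<in>{q0'..1}. p' t = p (\<alpha> t) \<and> \<Phi>' t = \<Phi> (\<alpha> t)))"

text \<open>
  \<open>(p, \<Phi>, q0)\<close>, which need not be admissible itself, attains \<open>ALG\<close>, and up to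
  reparametrization it is the one and only maximizer.
\<close>

definition unique_maximizer_upto_reparam ::
  "real ^ 's \<Rightarrow> (real ^ 's \<Rightarrow> real) \<Rightarrow> real ^ 's \<Rightarrow>
    (real \<Rightarrow> real) \<Rightarrow> (real \<Rightarrow> real ^ 's::finite) \<Rightarrow> real \<Rightarrow> bool" where
  "unique_maximizer_upto_reparam lam \<xi> h p \<Phi> q0 \<longleftrightarrow>
     ereal (alg_functional lam \<xi> h p \<Phi> q0) = ALG lam \<xi> h \<and>
     (\<exists>p' \<Phi>' q0'. maximizer lam \<xi> h p' \<Phi>' q0') \<and>
     (\<forall>p' \<Phi>' q0'. maximizer lam \<xi> h p' \<Phi>' q0' \<longleftrightarrow>
        feasible lam p' \<Phi>' q0' \<and> reparametrization p \<Phi> q0 p' \<Phi>' q0')"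

definition b_exponent :: "real ^ 's::finite \<Rightarrow> ('s \<Rightarrow> nat) \<Rightarrow> real \<Rightarrow> 's \<Rightarrow> real" where
  "b_exponent lam a L s = (1 - sqrt (real (a s) / (real (a s) + L * lam $ s))) / 2"

end

theory Submission
  imports Defs
begin

text \<open>
  Fix a feasible path \<open>(p, \<Phi>, q0)\<close> and put \<open>G = p * \<xi>(\<Phi>)\<close>. For a monomial,
  \<open>\<lambda>\<^sub>s \<Phi>\<^sub>s (p \<xi>\<^sup>s(\<Phi>)) = a\<^sub>s G\<close>; differentiating this and writing \<open>v\<^sub>s = G \<Phi>\<^sub>s' / \<Phi>\<^sub>s\<close> turns the
  integrand of the functional into
  \<open>(\<Sum>s. sqrt (\<lambda>\<^sub>s a\<^sub>s) * sqrt (v\<^sub>s * (G' - v\<^sub>s))) / sqrt G\<close>. Where \<open>G > 0\<close>, the logarithmic derivative of \<open>G\<close>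
  gives \<open>(\<Sum>s. a\<^sub>s v\<^sub>s) \<le> G'\<close>, with equality exactly when \<open>p' = 0\<close>.

  The problem is now pointwise: maximize a concave function of the \<open>v\<^sub>s\<close> under one linear
  constraint. The exponents \<open>b\<^sub>s\<close> solve its Lagrange conditions with multiplier \<open>\<mu> = 1 / sqrt L\<close>, so
  comparison with the tangent at \<open>v\<^sub>s = b\<^sub>s G'\<close> bounds the integrand by \<open>V * G' / sqrt G\<close>, where
  \<open>V = (\<Sum>s. sqrt (\<lambda>\<^sub>s a\<^sub>s b\<^sub>s (1 - b\<^sub>s)))\<close> (lemma \<open>sum_sqrt_le\<close>). This bound is the derivative of
  \<open>2 * V * sqrt G\<close> and \<open>G\<close> stays in \<open>[0, 1]\<close>, so the functional is at most \<open>2 * V\<close>.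

  Equality forces \<open>G\<close> to run from \<open>0\<close> to \<open>1\<close> and, wherever \<open>G > 0\<close>, both \<open>p' = 0\<close> and
  \<open>\<Phi>\<^sub>s' / \<Phi>\<^sub>s = b\<^sub>s G' / G\<close>. Integrating back from time \<open>1\<close> gives \<open>p = 1\<close> and \<open>\<Phi>\<^sub>s = G powr b\<^sub>s\<close>.
  All coordinates then vanish at the last zero of \<open>G\<close>, which by admissibility is time \<open>0\<close>. So \<open>G\<close>
  itself is the time change from the power law to the given maximizer. Conversely every power law
  attains \<open>2 * V\<close> by a direct computation, and one of them, run at the speed that makes it
  admissible, is feasible (lemma \<open>ex_feasible_power_law\<close>).

  For \<open>\<xi> = x\<^sub>1 x\<^sub>2\<close> the same argument applies with \<open>b\<^sub>s = 1/2\<close> and multiplier \<open>\<mu> = 0\<close>: the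
  unconstrained maximum of the pointwise problem already satisfies the constraint.
\<close>

section \<open>Continuously differentiable functions on an interval\<close>

text \<open>Continuous differentiability on \<open>[q0, 1]\<close>, one-sided at the endpoints.\<close>

definition C1_upto_one :: "real \<Rightarrow> (real \<Rightarrow> real) \<Rightarrow> bool" where
  "C1_upto_one q0 f \<longleftrightarrow> (\<exists>f'. continuous_on {q0..1} f' \<and>
     (\<forall>q\<in>{q0..1}. (f has_real_derivative f' q) (at q within {q0..1})))"

lemma incr_paths_iff:
  "f \<in> incr_paths q0 \<longleftrightarrow> f ` {q0..1} \<subseteq> {0..1} \<and> mono_on {q0..1} f \<and> C1_upto_one q0 f"
  by (auto simp: incr_paths_def C1_upto_one_def)

lemma C1_upto_one_continuous: "C1_upto_one q0 f \<Longrightarrow> continuous_on {q0..1} f"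
  unfolding C1_upto_one_def by (metis DERIV_continuous_on)

lemma C1_upto_one_deriv_extends:
  assumes "C1_upto_one q0 f"
  obtains f' where "continuous_on {q0..1} f'"
    and "\<And>q. q \<in> {q0<..<1} \<Longrightarrow> (f has_real_derivative f' q) (at q)"
    and "\<And>q. q \<in> {q0<..<1} \<Longrightarrow> deriv f q = f' q"
proof -
  obtain f' where c: "continuous_on {q0..1} f'"
    and d: "\<forall>q\<in>{q0..1}. (f has_real_derivative f' q) (at q within {q0..1})"
    using assms unfolding C1_upto_one_def by blast
  have D: "(f has_real_derivative f' q) (at q)" if "q \<in> {q0<..<1}" for q
    using bspec[OF d, of q] that at_within_Icc_at[of q0 q 1] by auto
  show thesis
    using that[OF c D] D DERIV_imp_deriv by blast
qed

lemma C1_upto_one_DERIV: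
  "C1_upto_one q0 f \<Longrightarrow> q \<in> {q0<..<1} \<Longrightarrow> (f has_real_derivative deriv f q) (at q)"
  by (metis C1_upto_one_deriv_extends)

lemma C1_upto_one_continuous_deriv:
  assumes "C1_upto_one q0 f" shows "continuous_on {q0<..<1} (deriv f)"
proof -
  obtain f' where f': "continuous_on {q0..1} f'" "\<And>q. q \<in> {q0<..<1} \<Longrightarrow> deriv f q = f' q"
    using C1_upto_one_deriv_extends[OF assms] by metis
  have "continuous_on {q0<..<1} f'" by (rule continuous_on_subset[OF f'(1)]) auto
  then show ?thesis by (rule continuous_on_eq) (simp add: f'(2))
qed

lemma C1_upto_one_const: "C1_upto_one q0 (\<lambda>_. c)"
  unfolding C1_upto_one_def by (intro exI[of _ "\<lambda>_. 0"]) auto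

lemma C1_upto_one_mult:
  assumes "C1_upto_one q0 f" "C1_upto_one q0 g"
  shows "C1_upto_one q0 (\<lambda>q. f q * g q)"
proof -
  have c: "continuous_on {q0..1} f" "continuous_on {q0..1} g"
    using assms C1_upto_one_continuous by blast+
  obtain f' where f': "continuous_on {q0..1} f'"
    "\<forall>q\<in>{q0..1}. (f has_real_derivative f' q) (at q within {q0..1})"
    using assms(1) unfolding C1_upto_one_def by blast
  obtain g' where g': "continuous_on {q0..1} g'"
    "\<forall>q\<in>{q0..1}. (g has_real_derivative g' q) (at q within {q0..1})"
    using assms(2) unfolding C1_upto_one_def by blast
  show ?thesis
    unfolding C1_upto_one_def
    by (rule exI[of _ "\<lambda>q. f' q * g q + g' q * f q"])
      (use f' g' c in \<open>auto intro!: continuous_intros DERIV_mult\<close>)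
qed

lemma C1_upto_one_power: "C1_upto_one q0 f \<Longrightarrow> C1_upto_one q0 (\<lambda>q. f q ^ n)"
  by (induction n) (auto intro: C1_upto_one_mult C1_upto_one_const)

lemma C1_upto_one_prod:
  "finite A \<Longrightarrow> (\<And>s. s \<in> A \<Longrightarrow> C1_upto_one q0 (f s)) \<Longrightarrow> C1_upto_one q0 (\<lambda>q. \<Prod>s\<in>A. f s q)"
  by (induction A rule: finite_induct) (auto intro: C1_upto_one_mult C1_upto_one_const)

lemma mono_on_mult_nonneg:
  fixes f g :: "real \<Rightarrow> real"
  assumes "mono_on S f" "mono_on S g" "\<And>t. t \<in> S \<Longrightarrow> 0 \<le> f t" "\<And>t. t \<in> S \<Longrightarrow> 0 \<le> g t"
  shows "mono_on S (\<lambda>t. f t * g t)"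
  by (rule mono_onI, rule mult_mono) (use assms in \<open>auto dest: mono_onD\<close>)

lemma DERIV_zero_at_interior_zero:
  fixes f :: "real \<Rightarrow> real"
  assumes "(f has_real_derivative d) (at q)" "q \<in> {u<..<v}" "f q = 0"
    and "\<And>t. t \<in> {u<..<v} \<Longrightarrow> 0 \<le> f t"
  shows "d = 0"
proof -
  have "\<exists>e>0. \<forall>t. \<bar>q - t\<bar> < e \<longrightarrow> t \<in> {u<..<v}"
    using assms(2) by (intro exI[of _ "min (q - u) (v - q)"]) auto
  then obtain e where "e > 0" "\<forall>t. \<bar>q - t\<bar> < e \<longrightarrow> t \<in> {u<..<v}" by blast
  then show ?thesis
    by (intro DERIV_local_min[OF assms(1), of e]) (use assms(3,4) in auto)
qed

lemma eq_on_left_closed: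
  fixes f g :: "real \<Rightarrow> real"
  assumes "u < v" "continuous_on {u..v} f" "continuous_on {u..v} g"
    and "\<And>t. t \<in> {u<..v} \<Longrightarrow> f t = g t"
  shows "f u = g u"
proof -
  have "(f \<longlongrightarrow> f u) (at_right u)" "(g \<longlongrightarrow> g u) (at_right u)"
    using assms(1-3) by (auto simp: continuous_on_Icc_at_rightD)
  moreover have "eventually (\<lambda>t. f t = g t) (at_right u)"
    using eventually_at_right_less[of u] eventually_at_right_real[OF assms(1)]
    by eventually_elim (use assms(4) in auto)
  ultimately have "(g \<longlongrightarrow> f u) (at_right u)"
    by (auto dest: tendsto_cong)
  then show ?thesis
    using \<open>(g \<longlongrightarrow> g u) (at_right u)\<close> tendsto_unique trivial_limit_at_right_real by blast
qed

section \<open>The tangent-line inequality\<close>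

text \<open>Concavity of \<open>v \<mapsto> sqrt (v * (g - v))\<close>: it lies below its tangent at \<open>v = b * g\<close>.\<close>

lemma sqrt_le_tangent:
  fixes v g b :: real
  assumes "0 < b" "b < 1" "0 \<le> v" "v \<le> g"
  defines "c \<equiv> sqrt (b * (1 - b))"
  shows "sqrt (v * (g - v)) \<le> (b * g + (1 - 2 * b) * v) / (2 * c)"
    and "sqrt (v * (g - v)) = (b * g + (1 - 2 * b) * v) / (2 * c) \<Longrightarrow> v = b * g"
proof -
  define X where "X = (1 - b) * v"
  define Y where "Y = b * (g - v)"
  have c: "c > 0" using assms by (auto simp: c_def)
  have XY: "X \<ge> 0" "Y \<ge> 0" using assms by (auto simp: X_def Y_def)
  have *: "c * sqrt (v * (g - v)) = sqrt (X * Y)"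
    by (simp add: c_def X_def Y_def real_sqrt_mult[symmetric] mult_ac)
  have sum: "b * g + (1 - 2 * b) * v = X + Y"
    by (simp add: X_def Y_def algebra_simps)
  have eq: "sqrt (v * (g - v)) = sqrt (X * Y) / c"
    using * c by (simp add: field_simps)
  show "sqrt (v * (g - v)) \<le> (b * g + (1 - 2 * b) * v) / (2 * c)"
    unfolding sum eq using arith_geo_mean_sqrt[OF XY] c by (simp add: field_simps)
  assume "sqrt (v * (g - v)) = (b * g + (1 - 2 * b) * v) / (2 * c)"
  then have "2 * sqrt (X * Y) = X + Y"
    unfolding sum eq using c by (simp add: field_simps)
  then have "4 * (X * Y) = (X + Y)\<^sup>2"
    using XY by (metis mult_nonneg_nonneg power_mult_distrib real_sqrt_pow2 four_x_squared)
  then have "(X - Y)\<^sup>2 = 0" by (simp add: power2_eq_square algebra_simps)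
  then show "v = b * g" by (simp add: X_def Y_def algebra_simps)
qed

section \<open>Monomials with critical exponents\<close>

text \<open>
  The exponents \<open>b\<close> are critical for the concave problem of maximizing
  \<open>\<Sum>s. sqrt (\<lambda>\<^sub>s a\<^sub>s \<beta>\<^sub>s (1 - \<beta>\<^sub>s))\<close> subject to \<open>(\<Sum>s. a\<^sub>s \<beta>\<^sub>s) \<le> 1\<close>: the constraint holds with
  equality, and the Lagrange condition holds with multiplier \<open>mu\<close>, cleared of denominators.
\<close>

locale critical_exponents =
  fixes lam :: "real ^ 's::finite" and a :: "'s \<Rightarrow> nat" and b :: "'s \<Rightarrow> real" and mu :: real
  assumes lam_pos: "0 < lam $ s" and lam_sum: "(\<Sum>s\<in>UNIV. lam $ s) = 1"
    and a_pos: "0 < a s" and b_pos: "0 < b s" and b_less_1: "b s < 1"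
    and mu_nonneg: "0 \<le> mu" and sum_ab: "(\<Sum>s\<in>UNIV. real (a s) * b s) = 1"
    and critical: "sqrt (lam $ s * real (a s)) * (1 - 2 * b s) = 2 * mu * real (a s) * sqrt (b s * (1 - b s))"
begin

text \<open>The monomial \<open>\<Prod>s. x\<^sub>s ^ a\<^sub>s\<close>.\<close>

definition xi :: "real ^ 's \<Rightarrow> real" where
  "xi x = (\<Prod>s\<in>UNIV. (x $ s) ^ a s)"

text \<open>The maximal value of the pointwise problem; the supremum of the functional is \<open>2 * rate\<close>.\<close>

definition rate :: real where
  "rate = (\<Sum>s\<in>UNIV. sqrt (lam $ s * real (a s) * (b s * (1 - b s))))"

lemma rate_pos: "0 < rate"
  unfolding rate_def
  by (rule sum_pos) (use lam_pos a_pos b_pos b_less_1 in auto)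

text \<open>The monomial divided by \<open>x\<^sub>s\<close>; unlike the quotient, it is meaningful at \<open>x\<^sub>s = 0\<close>.\<close>

definition cofactor :: "'s \<Rightarrow> real ^ 's \<Rightarrow> real" where
  "cofactor s x = (x $ s) ^ (a s - 1) * (\<Prod>j\<in>UNIV - {s}. (x $ j) ^ a j)"

lemma xi_cofactor: "xi x = x $ s * cofactor s x"
proof -
  have "xi x = (x $ s) ^ a s * (\<Prod>j\<in>UNIV - {s}. (x $ j) ^ a j)"
    unfolding xi_def by (rule prod.remove) auto
  also have "(x $ s) ^ a s = x $ s * (x $ s) ^ (a s - 1)"
    using a_pos[of s] by (metis Suc_diff_1 power_Suc)
  finally show ?thesis by (simp add: cofactor_def)
qed

lemma cofactor_zero: "x $ i = 0 \<Longrightarrow> i \<noteq> s \<Longrightarrow> cofactor s x = 0"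
  unfolding cofactor_def using a_pos[of i] by (auto intro!: prod_zero)

lemma cofactor_nonneg: "(\<And>j. 0 \<le> x $ j) \<Longrightarrow> 0 \<le> cofactor s x"
  unfolding cofactor_def by (auto intro!: mult_nonneg_nonneg prod_nonneg)

lemma xi_species_eq: "xi_species lam xi s x = real (a s) / lam $ s * cofactor s x"
proof -
  define K where "K = (\<Prod>j\<in>UNIV - {s}. (x $ j) ^ a j)"
  have "xi (x + t *\<^sub>R axis s 1) = (x $ s + t) ^ a s * K" for t
  proof -
    have "xi (x + t *\<^sub>R axis s 1) = ((x + t *\<^sub>R axis s 1) $ s) ^ a s *
        (\<Prod>j\<in>UNIV - {s}. ((x + t *\<^sub>R axis s 1) $ j) ^ a j)"
      unfolding xi_def by (rule prod.remove) auto
    also have "(\<Prod>j\<in>UNIV - {s}. ((x + t *\<^sub>R axis s 1) $ j) ^ a j) = K"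
      unfolding K_def by (rule prod.cong) (auto simp: axis_def)
    finally show ?thesis by (simp add: axis_def)
  qed
  then have "(\<lambda>t. xi (x + t *\<^sub>R axis s 1)) = (\<lambda>t. (x $ s + t) ^ a s * K)" by auto
  moreover have "((\<lambda>t. (x $ s + t) ^ a s * K) has_real_derivative
      real (a s) * (x $ s) ^ (a s - 1) * K) (at 0)"
    by (auto intro!: derivative_eq_intros)
  ultimately show ?thesis
    unfolding xi_species_def by (simp add: DERIV_imp_deriv cofactor_def K_def)
qed

text \<open>The solution of the pointwise problem, homogeneous of degree one in \<open>(v, g)\<close>: its maximum is
  \<open>rate * g\<close>, attained only at \<open>v\<^sub>s = b\<^sub>s g\<close>.\<close>

lemma sum_sqrt_le:
  assumes v: "\<And>s. 0 \<le> v s" and vg: "(\<Sum>s\<in>UNIV. real (a s) * v s) \<le> g"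
  shows "(\<Sum>s\<in>UNIV. sqrt (lam $ s * real (a s)) * sqrt (v s * (g - v s))) \<le> rate * g"
    and "(\<Sum>s\<in>UNIV. sqrt (lam $ s * real (a s)) * sqrt (v s * (g - v s))) = rate * g \<Longrightarrow> v s = b s * g"
proof -
  define w where "w s = sqrt (lam $ s * real (a s))" for s
  define c where "c s = sqrt (b s * (1 - b s))" for s
  \<comment> \<open>\<open>T s\<close> is the tangent at \<open>v s = b s * g\<close>; by criticality its slope is \<open>mu * a s\<close>.\<close>
  define T where "T s = w s * ((b s * g + (1 - 2 * b s) * v s) / (2 * c s))" for s
  have c: "0 < c s" "c s * c s = b s * (1 - b s)" for s
    using b_pos[of s] b_less_1[of s] by (auto simp: c_def)
  have w: "0 < w s" for s using lam_pos[of s] a_pos[of s] by (auto simp: w_def)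
  have v_le: "v s \<le> g" for s
  proof -
    have "v s \<le> real (a s) * v s" using v[of s] a_pos[of s]
      by (simp add: mult_le_cancel_right1)
    also have "\<dots> \<le> (\<Sum>s\<in>UNIV. real (a s) * v s)"
      by (rule member_le_sum) (use v in auto)
    finally show ?thesis using vg by simp
  qed
  have T: "w s * sqrt (v s * (g - v s)) \<le> T s" for s
    unfolding T_def c_def
    by (intro mult_left_mono sqrt_le_tangent(1) b_pos b_less_1 v v_le less_imp_le[OF w])
  have crit: "w s * (1 - 2 * b s) / (2 * c s) = mu * real (a s)" for s
  proof -
    have "w s * (1 - 2 * b s) = 2 * mu * real (a s) * c s"
      using critical[of s] by (simp add: w_def c_def)
    then show ?thesis using c(1)[of s] by simp
  qed
  have T_eq: "T s = w s * b s / (2 * c s) * g + mu * (real (a s) * v s)" for s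
    
  proof -
    have "T s = w s * b s / (2 * c s) * g + w s * (1 - 2 * b s) / (2 * c s) * v s"
      by (simp add: T_def add_divide_distrib distrib_left)
    then show ?thesis unfolding crit by simp
  qed
  have rate_eq: "(\<Sum>s\<in>UNIV. w s * b s / (2 * c s)) + mu = rate"
  proof -
    have "mu = (\<Sum>s\<in>UNIV. mu * real (a s) * b s)"
      using sum_ab by (simp add: mult.assoc flip: sum_distrib_left)
    also have "(\<Sum>s\<in>UNIV. w s * b s / (2 * c s)) + \<dots> =
        (\<Sum>s\<in>UNIV. w s * b s / (2 * c s) + w s * (1 - 2 * b s) / (2 * c s) * b s)"
      by (simp add: sum.distrib crit)
    also have "\<dots> = (\<Sum>s\<in>UNIV. w s * c s)"
    proof (rule sum.cong)
      fix s
      have "w s * b s / (2 * c s) + w s * (1 - 2 * b s) / (2 * c s) * b s = w s * (b s * (1 - b s)) / c s"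
        using c(1)[of s] by (simp add: field_simps)
      also have "\<dots> = w s * c s" using c(1)[of s] by (simp add: c(2)[symmetric])
      finally show "w s * b s / (2 * c s) + w s * (1 - 2 * b s) / (2 * c s) * b s = w s * c s" .
    qed simp
    finally show ?thesis by (simp add: rate_def w_def c_def real_sqrt_mult)
  qed
  have sumT: "sum T UNIV \<le> rate * g"
  proof -
    have "sum T UNIV = (\<Sum>s\<in>UNIV. w s * b s / (2 * c s)) * g + mu * (\<Sum>s\<in>UNIV. real (a s) * v s)"
      by (simp add: T_eq sum.distrib sum_distrib_left sum_distrib_right)
    also have "\<dots> \<le> (\<Sum>s\<in>UNIV. w s * b s / (2 * c s)) * g + mu * g"
      using mult_left_mono[OF vg mu_nonneg] by simp
    finally show ?thesis by (simp add: rate_eq[symmetric] algebra_simps)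
  qed
  show le: "(\<Sum>s\<in>UNIV. sqrt (lam $ s * real (a s)) * sqrt (v s * (g - v s))) \<le> rate * g"
    using sum_mono[of UNIV "\<lambda>s. w s * sqrt (v s * (g - v s))" T] T sumT by (simp add: w_def)
  assume "(\<Sum>s\<in>UNIV. sqrt (lam $ s * real (a s)) * sqrt (v s * (g - v s))) = rate * g"
  then have "sum T UNIV \<le> (\<Sum>s\<in>UNIV. w s * sqrt (v s * (g - v s)))"
    using sumT by (simp add: w_def)
  then have "(\<Sum>s\<in>UNIV. T s - w s * sqrt (v s * (g - v s))) \<le> 0"
    by (simp add: sum_subtractf)
  moreover have "(\<Sum>s\<in>UNIV. T s - w s * sqrt (v s * (g - v s))) \<ge> 0"
    by (rule sum_nonneg) (use T in auto)
  ultimately have "(\<Sum>s\<in>UNIV. T s - w s * sqrt (v s * (g - v s))) = 0" by simp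
  then have "T s - w s * sqrt (v s * (g - v s)) = 0" 
    by (subst (asm) sum_nonneg_eq_0_iff) (use T in auto)
  then have "w s * sqrt (v s * (g - v s)) = w s * ((b s * g + (1 - 2 * b s) * v s) / (2 * c s))"
    by (simp only: T_def right_minus_eq)
  then have "sqrt (v s * (g - v s)) = (b s * g + (1 - 2 * b s) * v s) / (2 * c s)"
    using less_imp_neq[OF w[of s]] by (simp only: mult_left_cancel)
  then show "v s = b s * g"
    unfolding c_def by (rule sqrt_le_tangent(2)[OF b_pos b_less_1 v v_le])
qed

end

section \<open>The upper bound along a feasible path\<close>

text \<open>A feasible path. Its derivatives are taken with the two-sided \<open>deriv\<close>, at interior times only.\<close>

locale feasible_path = critical_exponents lam a b mu
  for lam :: "real ^ 's::finite" and a :: "'s \<Rightarrow> nat" and b :: "'s \<Rightarrow> real" and mu :: real +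
  fixes p :: "real \<Rightarrow> real" and \<Phi> :: "real \<Rightarrow> real ^ 's" and q0 :: real
  assumes feasible: "feasible lam p \<Phi> q0"
begin

text \<open>The value of \<open>p * \<xi>\<close> along the path; it measures the progress of the path.\<close>

definition G :: "real \<Rightarrow> real" where "G t = p t * xi (\<Phi> t)"

text \<open>The function \<open>p \<times> \<xi>\<^sup>s \<circ> \<Phi>\<close> whose derivative enters the functional.\<close>

definition M :: "'s \<Rightarrow> real \<Rightarrow> real" where "M s t = p t * xi_species lam xi s (\<Phi> t)"

text \<open>The integrands of the functional, summed over the species.\<close>

definition integrand :: "real \<Rightarrow> real" where
  "integrand q = (\<Sum>s\<in>UNIV. lam $ s * sqrt (deriv (\<lambda>t. \<Phi> t $ s) q * deriv (M s) q))"

lemma q0: "0 \<le> q0" "q0 \<le> 1"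
  using feasible by (auto simp: feasible_def)

lemma p_incr: "p \<in> incr_paths q0"
  and \<Phi>_incr: "(\<lambda>t. \<Phi> t $ s) \<in> incr_paths q0"
  and admissible: "t \<in> {q0..1} \<Longrightarrow> (\<Sum>s\<in>UNIV. lam $ s * \<Phi> t $ s) = t"
  using feasible by (auto simp: feasible_def Adm_def)

lemma p_C1: "C1_upto_one q0 p" and \<Phi>_C1: "C1_upto_one q0 (\<lambda>t. \<Phi> t $ s)"
  using p_incr \<Phi>_incr by (auto simp: incr_paths_iff)

lemma p_range: "t \<in> {q0..1} \<Longrightarrow> 0 \<le> p t \<and> p t \<le> 1"
  and \<Phi>_range: "t \<in> {q0..1} \<Longrightarrow> 0 \<le> \<Phi> t $ s \<and> \<Phi> t $ s \<le> 1"
  using p_incr \<Phi>_incr[of s] by (auto simp: incr_paths_iff image_subset_iff)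

lemma p_mono: "mono_on {q0..1} p" and \<Phi>_mono: "mono_on {q0..1} (\<lambda>t. \<Phi> t $ s)"
  using p_incr \<Phi>_incr[of s] by (auto simp: incr_paths_iff)

lemma xi_range: "t \<in> {q0..1} \<Longrightarrow> 0 \<le> xi (\<Phi> t) \<and> xi (\<Phi> t) \<le> 1"
  unfolding xi_def using \<Phi>_range by (auto intro!: prod_nonneg prod_le_1 power_le_one)

lemma cofactor_\<Phi>_nonneg: "t \<in> {q0..1} \<Longrightarrow> 0 \<le> cofactor s (\<Phi> t)"
  using \<Phi>_range cofactor_nonneg by blast

lemma xi_mono: "mono_on {q0..1} (\<lambda>t. xi (\<Phi> t))"
proof (rule mono_onI)
  fix t u assume *: "t \<in> {q0..1}" "u \<in> {q0..1}" "t \<le> u"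
  show "xi (\<Phi> t) \<le> xi (\<Phi> u)"
    unfolding xi_def
  proof (rule prod_mono)
    fix s
    show "0 \<le> (\<Phi> t $ s) ^ a s \<and> (\<Phi> t $ s) ^ a s \<le> (\<Phi> u $ s) ^ a s"
      using \<Phi>_range[OF *(1), of s] mono_onD[OF \<Phi>_mono[of s] *] by (simp add: power_mono)
  qed
qed

lemma G_mono: "mono_on {q0..1} G"
  unfolding G_def[abs_def]
  by (rule mono_on_mult_nonneg[OF p_mono xi_mono]) (use p_range xi_range in auto)

lemma G_range: "t \<in> {q0..1} \<Longrightarrow> 0 \<le> G t \<and> G t \<le> 1"
  unfolding G_def using p_range xi_range by (auto intro!: mult_le_one)

lemma G_C1: "C1_upto_one q0 G"
  unfolding G_def[abs_def] xi_def
  by (intro C1_upto_one_mult p_C1 C1_upto_one_prod C1_upto_one_power \<Phi>_C1) auto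

lemma M_eq: "M s t = real (a s) / lam $ s * (p t * cofactor s (\<Phi> t))"
  by (simp add: M_def xi_species_eq)

lemma M_C1: "C1_upto_one q0 (M s)"
  unfolding M_eq[abs_def] cofactor_def
  by (intro C1_upto_one_mult C1_upto_one_const p_C1 C1_upto_one_prod C1_upto_one_power \<Phi>_C1) auto

lemma M_nonneg: "t \<in> {q0..1} \<Longrightarrow> 0 \<le> M s t"
  unfolding M_eq using p_range cofactor_\<Phi>_nonneg less_imp_le[OF lam_pos[of s]] by auto

lemma deriv_nonneg_of_mono:
  assumes "mono_on {q0..1} f" "C1_upto_one q0 f" "q \<in> {q0<..<1}"
  shows "0 \<le> deriv f q"
  by (rule mono_on_imp_deriv_nonneg[OF assms(1) C1_upto_one_DERIV[OF assms(2,3)]]) (use assms(3) in auto)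

lemma alg_functional_eq:
  "alg_functional lam xi 0 p \<Phi> q0 = integral {q0..1} integrand"
  "integrand integrable_on {q0..1}"
proof -
  define J where "J s q = sqrt (deriv (\<lambda>t. \<Phi> t $ s) q * deriv (M s) q)" for s q
  have J: "J s integrable_on {q0..1}" for s
  proof -
    obtain x' where x': "continuous_on {q0..1} x'" "\<And>q. q \<in> {q0<..<1} \<Longrightarrow> deriv (\<lambda>t. \<Phi> t $ s) q = x' q"
      using C1_upto_one_deriv_extends[OF \<Phi>_C1[of s]] by metis
    obtain m' where m': "continuous_on {q0..1} m'" "\<And>q. q \<in> {q0<..<1} \<Longrightarrow> deriv (M s) q = m' q"
      using C1_upto_one_deriv_extends[OF M_C1[of s]] by metis
    have "(\<lambda>q. sqrt (x' q * m' q)) integrable_on {q0..1}"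
      by (intro integrable_continuous_real continuous_intros x' m')
    then show ?thesis
      by (rule integrable_spike_finite[of "{q0, 1}", rotated 2]) (auto simp: J_def x' m')
  qed
  have d: "integrand = (\<lambda>q. \<Sum>s\<in>UNIV. lam $ s * J s q)"
    by (simp add: integrand_def[abs_def] J_def)
  show "integrand integrable_on {q0..1}"
    unfolding d by (intro integrable_sum integrable_on_mult_right J) auto
  have "integral {q0..1} integrand = (\<Sum>s\<in>UNIV. integral {q0..1} (\<lambda>q. lam $ s * J s q))"
    unfolding d by (intro integral_sum integrable_on_mult_right J) auto
  also have "\<dots> = (\<Sum>s\<in>UNIV. lam $ s * integral {q0..1} (J s))"
    by (simp add: J integral_mult_right)
  finally show "alg_functional lam xi 0 p \<Phi> q0 = integral {q0..1} integrand"
    by (simp add: alg_functional_def J_def[abs_def] M_def[abs_def])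
qed

text \<open>Where \<open>G\<close> vanishes, one factor of the product vanishes, hence has an interior minimum.\<close>

lemma integrand_zero:
  assumes q: "q \<in> {q0<..<1}" and G0: "G q = 0"
  shows "integrand q = 0"
proof -
  have M0: "deriv (M s) q = 0" if "M s q = 0" for s
    by (rule DERIV_zero_at_interior_zero[OF C1_upto_one_DERIV[OF M_C1 q] q that])
      (use M_nonneg in auto)
  have x0: "deriv (\<lambda>t. \<Phi> t $ s) q = 0" if "\<Phi> q $ s = 0" for s
    by (rule DERIV_zero_at_interior_zero[OF C1_upto_one_DERIV[OF \<Phi>_C1 q] q that])
      (use \<Phi>_range in auto)
  have "deriv (\<lambda>t. \<Phi> t $ s) q * deriv (M s) q = 0" for s
  proof (cases "p q = 0")
    case True
    then show ?thesis using M0 by (simp add: M_eq)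
  next
    case False
    then have "xi (\<Phi> q) = 0" using G0 by (simp add: G_def)
    then obtain i where i: "\<Phi> q $ i = 0" by (auto simp: xi_def)
    show ?thesis
    proof (cases "i = s")
      case True
      then show ?thesis using x0 i by simp
    next
      case False
      then have "M s q = 0" using cofactor_zero[OF i] by (simp add: M_eq)
      then show ?thesis using M0 by simp
    qed
  qed
  then show ?thesis
    unfolding integrand_def by (simp only: real_sqrt_zero mult_zero_right sum.neutral_const)
qed

text \<open>The logarithmic derivative of \<open>\<Phi>\<^sub>s\<close>, multiplied by \<open>G\<close> so that it is comparable with \<open>G'\<close>.\<close>

definition v :: "real \<Rightarrow> 's \<Rightarrow> real" where
  "v q s = G q * deriv (\<lambda>t. \<Phi> t $ s) q / \<Phi> q $ s"

lemma positive_point: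
  assumes q: "q \<in> {q0<..<1}" and G: "0 < G q"
  shows "0 < p q" "0 < \<Phi> q $ s" "0 < xi (\<Phi> q)"
    "deriv G q = deriv p q * xi (\<Phi> q) + (\<Sum>s\<in>UNIV. real (a s) * v q s)"
    "0 \<le> v q s" "(\<Sum>s\<in>UNIV. real (a s) * v q s) \<le> deriv G q"
proof -
  have q': "q \<in> {q0..1}" using q by auto
  show p: "0 < p q" using G p_range[OF q'] xi_range[OF q'] 
    by (auto simp: G_def zero_less_mult_iff)
  show xi: "0 < xi (\<Phi> q)" using G p_range[OF q'] xi_range[OF q'] 
    by (auto simp: G_def zero_less_mult_iff)
  have x: "0 < \<Phi> q $ s" for s
  proof -
    have "\<Phi> q $ s \<noteq> 0" using xi xi_cofactor[of "\<Phi> q" s] by auto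
    then show ?thesis using \<Phi>_range[OF q', of s] by simp
  qed
  show "0 < \<Phi> q $ s" by (rule x)
  have "((\<lambda>t. xi (\<Phi> t)) has_real_derivative
      xi (\<Phi> q) * (\<Sum>s\<in>UNIV. real (a s) * (\<Phi> q $ s) ^ (a s - 1) * deriv (\<lambda>t. \<Phi> t $ s) q / (\<Phi> q $ s) ^ a s)) (at q)"
    unfolding xi_def
    by (rule has_field_derivative_prod')
      (use x in \<open>auto intro!: derivative_eq_intros C1_upto_one_DERIV[OF \<Phi>_C1 q] simp: less_imp_neq[symmetric]\<close>)
  moreover have "real (a s) * (\<Phi> q $ s) ^ (a s - 1) * y / (\<Phi> q $ s) ^ a s = real (a s) * (y / \<Phi> q $ s)" for s y
    using x[of s] a_pos[of s] by (cases "a s") auto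
  ultimately have xi': "((\<lambda>t. xi (\<Phi> t)) has_real_derivative
      xi (\<Phi> q) * (\<Sum>s\<in>UNIV. real (a s) * (deriv (\<lambda>t. \<Phi> t $ s) q / \<Phi> q $ s))) (at q)"
    by simp
  have "(G has_real_derivative
      deriv p q * xi (\<Phi> q) + xi (\<Phi> q) * (\<Sum>s\<in>UNIV. real (a s) * (deriv (\<lambda>t. \<Phi> t $ s) q / \<Phi> q $ s)) * p q) (at q)"
    unfolding G_def[abs_def] by (rule DERIV_mult[OF C1_upto_one_DERIV[OF p_C1 q] xi'])
  moreover have "xi (\<Phi> q) * (\<Sum>s\<in>UNIV. real (a s) * (deriv (\<lambda>t. \<Phi> t $ s) q / \<Phi> q $ s)) * p q
      = (\<Sum>s\<in>UNIV. real (a s) * v q s)"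
    by (simp add: v_def G_def sum_distrib_left sum_distrib_right mult_ac)
  ultimately show g: "deriv G q = deriv p q * xi (\<Phi> q) + (\<Sum>s\<in>UNIV. real (a s) * v q s)"
    by (simp add: DERIV_imp_deriv)
  show "0 \<le> v q s" unfolding v_def
    using G x[of s] deriv_nonneg_of_mono[OF \<Phi>_mono \<Phi>_C1 q] by (simp add: less_imp_le)
  show "(\<Sum>s\<in>UNIV. real (a s) * v q s) \<le> deriv G q"
    unfolding g using deriv_nonneg_of_mono[OF p_mono p_C1 q] xi by simp
qed

lemma integrand_eq:
  assumes q: "q \<in> {q0<..<1}" and G: "0 < G q"
  shows "integrand q = (\<Sum>s\<in>UNIV. sqrt (lam $ s * real (a s)) * sqrt (v q s * (deriv G q - v q s))) / sqrt (G q)"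
proof -
  have "lam $ s * sqrt (deriv (\<lambda>t. \<Phi> t $ s) q * deriv (M s) q) =
      sqrt (lam $ s * real (a s)) * sqrt (v q s * (deriv G q - v q s)) / sqrt (G q)" for s
  proof -
    define x where "x = \<Phi> q $ s"
    define x' where "x' = deriv (\<lambda>t. \<Phi> t $ s) q"
    define m' where "m' = deriv (M s) q"
    have x: "0 < x" using positive_point(2)[OF q G] by (simp add: x_def)
    have l: "0 < lam $ s" by (rule lam_pos)
    \<comment> \<open>\<open>\<Phi>\<^sub>s M\<^sub>s = a\<^sub>s G / \<lambda>\<^sub>s\<close>; differentiating this gives \<open>M\<^sub>s'\<close>.\<close>
    have eq: "(\<lambda>t. \<Phi> t $ s * M s t) = (\<lambda>t. real (a s) / lam $ s * G t)"
      by (rule ext) (simp add: M_eq G_def xi_cofactor[of _ s] mult_ac)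
    have "((\<lambda>t. \<Phi> t $ s * M s t) has_real_derivative x' * M s q + m' * x) (at q)"
      unfolding x_def x'_def m'_def by (intro DERIV_mult C1_upto_one_DERIV[OF _ q] \<Phi>_C1 M_C1)
    moreover have "((\<lambda>t. \<Phi> t $ s * M s t) has_real_derivative real (a s) / lam $ s * deriv G q) (at q)"
      unfolding eq by (intro DERIV_cmult C1_upto_one_DERIV[OF _ q] G_C1)
    ultimately have "x' * M s q + m' * x = real (a s) / lam $ s * deriv G q"
      by (rule DERIV_unique)
    moreover have "M s q = real (a s) / lam $ s * G q / x"
    proof -
      have "M s q * x = real (a s) / lam $ s * G q"
        using fun_cong[OF eq, of q] by (simp add: x_def mult.commute)
      then show ?thesis using x by (metis less_irrefl nonzero_eq_divide_eq)
    qed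
    ultimately have m': "m' = real (a s) / lam $ s * (deriv G q - v q s) / x"
      using x by (simp only: v_def x_def[symmetric] x'_def[symmetric])
        (simp add: eq_divide_eq algebra_simps del: times_divide_eq_left)
    have x': "x' = v q s * x / G q"
      using x G by (simp add: v_def x_def[symmetric] x'_def[symmetric])
    have "x' * m' = (real (a s) / lam $ s) * (v q s * (deriv G q - v q s)) / G q"
      unfolding x' m' using x by (simp add: mult_ac)
    moreover have "lam $ s * sqrt ((real (a s) / lam $ s) * Z / G q) = sqrt (lam $ s * real (a s)) * sqrt Z / sqrt (G q)" for Z
    proof -
      define r where "r = sqrt (lam $ s)"
      have "lam $ s = r * r" "0 < r" using l by (simp_all add: r_def)
      then show ?thesis by (simp add: real_sqrt_mult real_sqrt_divide)
    qed
    ultimately show ?thesis by (simp add: x'_def m'_def)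
  qed
  then show ?thesis unfolding integrand_def by (simp add: sum_divide_distrib)
qed

lemma integrand_le:
  assumes q: "q \<in> {q0<..<1}"
  shows "integrand q \<le> rate * (deriv G q / sqrt (G q))"
proof (cases "G q = 0")
  case True
  then show ?thesis using integrand_zero[OF q] by simp
next
  case False
  then have G: "0 < G q" using G_range[of q] q by fastforce
  show ?thesis
    unfolding integrand_eq[OF q G] times_divide_eq_right
    by (intro divide_right_mono sum_sqrt_le(1) positive_point[OF q G]) (use G in auto)
qed

lemma integrand_extremal:
  assumes q: "q \<in> {q0<..<1}" and G: "0 < G q" and eq: "integrand q = rate * (deriv G q / sqrt (G q))"
  shows "v q s = b s * deriv G q" "deriv p q = 0"
proof -
  have *: "(\<Sum>s\<in>UNIV. sqrt (lam $ s * real (a s)) * sqrt (v q s * (deriv G q - v q s))) = rate * deriv G q"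
    using eq G unfolding integrand_eq[OF q G] by simp
  show v: "v q s = b s * deriv G q" for s
    by (rule sum_sqrt_le(2)[OF _ _ *]) (intro positive_point[OF q G])+
  have "(\<Sum>s\<in>UNIV. real (a s) * v q s) = (\<Sum>s\<in>UNIV. real (a s) * b s) * deriv G q"
    by (simp add: v sum_distrib_left sum_distrib_right mult_ac)
  then show "deriv p q = 0"
    using positive_point(4)[OF q G] positive_point(3)[OF q G] by (simp add: sum_ab)
qed

text \<open>Since \<open>G\<close> is monotone, its zeros form an initial segment of the time interval.\<close>

lemma zero_threshold:
  obtains t0 where "t0 \<in> {q0..1}" "\<And>t. t \<in> {q0..1} \<Longrightarrow> t < t0 \<Longrightarrow> G t = 0"
    "\<And>t. t \<in> {q0..1} \<Longrightarrow> t0 < t \<Longrightarrow> 0 < G t" "G q0 = 0 \<Longrightarrow> G t0 = 0"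
proof (cases "G q0 = 0")
  case False
  have "0 < G t" if "t \<in> {q0..1}" for t
    using mono_onD[OF G_mono, of q0 t] that False G_range[of q0] q0 by auto
  then show ?thesis using that[of q0] False q0 by auto
next
  case True
  define Z where "Z = {t \<in> {q0..1}. G t = 0}"
  have Z: "q0 \<in> Z" "bdd_above Z" using True q0 by (auto simp: Z_def intro!: bdd_aboveI[of _ 1])
  have "closed Z"
    unfolding Z_def by (rule continuous_closed_preimage_constant[OF C1_upto_one_continuous[OF G_C1]]) auto
  then have S: "Sup Z \<in> Z" using Z closed_contains_Sup by blast
  show ?thesis
  proof (rule that[of "Sup Z"])
    fix t assume t: "t \<in> {q0..1}"
    show "G t = 0" if "t < Sup Z"
      using mono_onD[OF G_mono t, of "Sup Z"] S that G_range[OF t] by (auto simp: Z_def)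
    show "0 < G t" if "Sup Z < t"
    proof -
      have "t \<notin> Z" using cSup_upper[OF _ Z(2), of t] that by auto
      then show ?thesis using G_range[OF t] t by (auto simp: Z_def less_le)
    qed
  qed (use S in \<open>auto simp: Z_def\<close>)
qed

text \<open>The pointwise bound is the derivative of \<open>2 * rate * sqrt G\<close>, except possibly at the time where \<open>G\<close>
  leaves \<open>0\<close>.\<close>

lemma bound_has_integral:
  "((\<lambda>q. rate * (deriv G q / sqrt (G q))) has_integral 2 * rate * (sqrt (G 1) - sqrt (G q0))) {q0..1}"
proof -
  obtain t0 where t0: "t0 \<in> {q0..1}" "\<And>t. t \<in> {q0..1} \<Longrightarrow> t < t0 \<Longrightarrow> G t = 0"
    "\<And>t. t \<in> {q0..1} \<Longrightarrow> t0 < t \<Longrightarrow> 0 < G t"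
    using zero_threshold by metis
  have "((\<lambda>q. rate * (deriv G q / sqrt (G q))) has_integral 2 * rate * sqrt (G 1) - 2 * rate * sqrt (G q0)) {q0..1}"
  proof (rule fundamental_theorem_of_calculus_interior_strong[of "{t0}"])
    show "continuous_on {q0..1} (\<lambda>q. 2 * rate * sqrt (G q))"
      by (intro continuous_intros C1_upto_one_continuous G_C1)
    fix q assume "q \<in> {q0<..<1} - {t0}"
    then have q: "q \<in> {q0<..<1}" "q \<noteq> t0" by auto
    have "((\<lambda>q. 2 * rate * sqrt (G q)) has_real_derivative rate * (deriv G q / sqrt (G q))) (at q)"
    proof (cases "q < t0")
      case True
      \<comment> \<open>Here \<open>G\<close> vanishes near \<open>q\<close>, and the bound is \<open>0\<close> because \<open>deriv G q / sqrt 0 = 0\<close>.\<close>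
      have "eventually (\<lambda>t. t \<in> {q0<..<t0}) (nhds q)"
        by (rule eventually_nhds_in_open) (use q True in auto)
      then have ev: "eventually (\<lambda>t. 2 * rate * sqrt (G t) = 0) (nhds q)"
        by eventually_elim (use t0 in auto)
      have "G q = 0" using t0 q True by auto
      then show ?thesis using DERIV_cong_ev[OF refl ev refl, of 0] by simp
    next
      case False
      then have G: "0 < G q" using t0 q by auto
      have "((\<lambda>q. 2 * rate * sqrt (G q)) has_real_derivative
          2 * rate * (inverse (sqrt (G q)) / 2 * deriv G q)) (at q)"
        by (intro DERIV_cmult DERIV_chain2[where f = sqrt] DERIV_real_sqrt G
            C1_upto_one_DERIV[OF G_C1 q(1)])
      also have "2 * rate * (inverse (sqrt (G q)) / 2 * deriv G q) = rate * (deriv G q / sqrt (G q))"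
        using G by (simp add: field_simps)
      finally show ?thesis .
    qed
    then show "((\<lambda>q. 2 * rate * sqrt (G q)) has_vector_derivative rate * (deriv G q / sqrt (G q))) (at q)"
      by (simp add: has_real_derivative_iff_has_vector_derivative)
  qed (use q0 in auto)
  then show ?thesis by (simp add: algebra_simps)
qed

lemma slack_has_integral:
  "((\<lambda>q. rate * (deriv G q / sqrt (G q)) - integrand q) has_integral
     2 * rate * (sqrt (G 1) - sqrt (G q0)) - alg_functional lam xi 0 p \<Phi> q0) {q0<..<1}"
proof -
  have "((\<lambda>q. rate * (deriv G q / sqrt (G q)) - integrand q) has_integral
     2 * rate * (sqrt (G 1) - sqrt (G q0)) - alg_functional lam xi 0 p \<Phi> q0) {q0..1}"
    unfolding alg_functional_eq(1)
    by (intro has_integral_diff bound_has_integral integrable_integral alg_functional_eq(2))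
  then show ?thesis
    by (rule iffD2[OF has_integral_open_interval[of _ _ q0 "1::real", unfolded box_real]])
qed

lemma alg_functional_le:
  "alg_functional lam xi 0 p \<Phi> q0 \<le> 2 * rate * (sqrt (G 1) - sqrt (G q0))"
  using has_integral_nonneg[OF slack_has_integral] integrand_le by auto

lemma alg_functional_le_rate: "alg_functional lam xi 0 p \<Phi> q0 \<le> 2 * rate"
proof -
  have "sqrt (G 1) - sqrt (G q0) \<le> 1"
    using G_range[of 1] G_range[of q0] q0 by (smt (verit) atLeastAtMost_iff real_sqrt_ge_zero real_sqrt_le_1_iff)
  then have "2 * rate * (sqrt (G 1) - sqrt (G q0)) \<le> 2 * rate"
    using rate_pos by simp
  then show ?thesis using alg_functional_le by linarith
qed

text \<open>If the bound \<open>2 * rate\<close> is attained, then \<open>G\<close> runs from \<open>0\<close> to \<open>1\<close> and the pointwise bound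
  is an equality wherever \<open>G\<close> is positive.\<close>

lemma extremal_pointwise:
  assumes max: "alg_functional lam xi 0 p \<Phi> q0 = 2 * rate"
  shows "G 1 = 1" "G q0 = 0"
    and "q \<in> {q0<..<1} \<Longrightarrow> 0 < G q \<Longrightarrow> integrand q = rate * (deriv G q / sqrt (G q))"
proof -
  have r: "0 \<le> G 1" "G 1 \<le> 1" "0 \<le> G q0" using G_range[of 1] G_range[of q0] q0 by auto
  have "2 * rate * 1 \<le> 2 * rate * (sqrt (G 1) - sqrt (G q0))"
    using alg_functional_le max by simp
  then have "1 \<le> sqrt (G 1) - sqrt (G q0)" using rate_pos by simp
  moreover have "sqrt (G 1) \<le> 1" "0 \<le> sqrt (G q0)" using r by auto
  ultimately have "sqrt (G 1) = 1" "sqrt (G q0) = 0" by linarith+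
  then show G1: "G 1 = 1" and G0: "G q0 = 0" by auto
  assume q: "q \<in> {q0<..<1}" and G: "0 < G q"
  define S where "S q = rate * (deriv G q / sqrt (G q)) - integrand q" for q
  have S0: "(S has_integral 0) {q0<..<1}"
    using slack_has_integral by (simp only: S_def[abs_def] max G1 G0 real_sqrt_one real_sqrt_zero) simp
  have S_nonneg: "0 \<le> S t" if "t \<in> {q0<..<1}" for t
    using integrand_le[OF that] by (simp add: S_def)
  obtain w where w: "q < w" "w < 1" using dense[of q 1] q by auto
  have sub: "{q..w} \<subseteq> {q0<..<1}" using q w by auto
  have Gpos: "0 < G t" if "t \<in> {q..w}" for t
    using mono_onD[OF G_mono, of q t] that q w G by auto
  have cont: "continuous_on {q..w} S"
    unfolding S_def integrand_def
    by (intro continuous_intros continuous_on_subset[OF C1_upto_one_continuous_deriv sub]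
        continuous_on_subset[OF C1_upto_one_continuous[OF G_C1]] G_C1 \<Phi>_C1 M_C1)
      (use Gpos sub in force)+
  then have int: "S integrable_on {q..w}" by (rule integrable_continuous_real)
  have "integral {q..w} S \<le> integral {q0<..<1} S"
    by (rule integral_subset_le[OF sub int]) (use S0 S_nonneg in auto)
  then have "integral {q..w} S \<le> 0" using S0 by (simp add: integral_unique)
  moreover have "0 \<le> integral {q..w} S"
    by (rule integral_nonneg[OF int]) (use S_nonneg sub in auto)
  ultimately have "integral {q..w} S = 0" by simp
  then have "(S has_integral 0) (cbox q w)"
    using integrable_integral[OF int] by simp
  then have "S q = 0"
    by (rule has_integral_0_cbox_imp_0[rotated 2]) (use cont w S_nonneg q in auto)
  then show "integrand q = rate * (deriv G q / sqrt (G q))" by (simp add: S_def)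
qed

lemma \<Phi>_at_1: "\<Phi> 1 $ s = 1"
proof -
  have x: "\<Phi> 1 $ j \<le> 1" for j using \<Phi>_range[of 1] q0 by auto
  have "(\<Sum>j\<in>UNIV. lam $ j * (1 - \<Phi> 1 $ j)) = 0"
    using admissible[of 1] lam_sum q0 by (simp add: right_diff_distrib sum_subtractf)
  then have "lam $ s * (1 - \<Phi> 1 $ s) = 0"
    by (subst (asm) sum_nonneg_eq_0_iff) (use x less_imp_le[OF lam_pos] in auto)
  then show ?thesis using lam_pos[of s] by simp
qed

text \<open>Equality in the pointwise bound is the linear differential equation
  \<open>\<Phi>\<^sub>s' / \<Phi>\<^sub>s = b\<^sub>s G' / G\<close>.\<close>

lemma extremal_powr:
  assumes max: "alg_functional lam xi 0 p \<Phi> q0 = 2 * rate"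
    and t: "t \<in> {q0..1}" "0 < G t"
  shows "\<Phi> t $ s = G t powr b s" "p t = 1"
proof -
  have G1: "G 1 = 1" and G0: "G q0 = 0" by (rule extremal_pointwise[OF max])+
  have t0: "q0 < t" using t G0 by (cases "q0 = t") auto
  have p1: "p 1 = 1" using G1 \<Phi>_at_1 by (simp add: G_def xi_def)
  have "\<Phi> t $ s = G t powr b s \<and> p t = 1"
  proof (cases "t = 1")
    case True
    then show ?thesis using \<Phi>_at_1 G1 p1 by simp
  next
    case False
    then have lt: "t < 1" using t by simp
    have sub: "{t..1} \<subseteq> {q0..1}" using t0 by auto
    have Gpos: "0 < G u" if "u \<in> {t..1}" for u
      using mono_onD[OF G_mono, of t u] that t by auto
    have xpos: "0 < \<Phi> u $ s" if "u \<in> {t..1}" for u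
    proof (cases "u = 1")
      case False
      then show ?thesis using that positive_point(2)[OF _ Gpos[OF that], of s] t0 by auto
    qed (use \<Phi>_at_1 in auto)
    define R where "R u = ln (\<Phi> u $ s) - b s * ln (G u)" for u
    have cont: "continuous_on {t..1} R"
      unfolding R_def
      by (intro continuous_intros continuous_on_subset[OF C1_upto_one_continuous sub] G_C1 \<Phi>_C1)
        (use Gpos xpos in force)+
    have "R 1 = R t"
    proof (rule DERIV_isconst2[OF lt cont])
      fix u assume u: "t < u" "u < 1"
      have q: "u \<in> {q0<..<1}" "0 < G u" "0 < \<Phi> u $ s" using u t0 Gpos xpos by auto
      have "v u s = b s * deriv G u"
        by (rule integrand_extremal(1)[OF q(1,2) extremal_pointwise(3)[OF max q(1,2)]])
      then have e: "1 / \<Phi> u $ s * deriv (\<lambda>t. \<Phi> t $ s) u - b s * (1 / G u * deriv G u) = 0"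
        using q by (simp add: v_def field_simps)
      have "(R has_real_derivative
          1 / \<Phi> u $ s * deriv (\<lambda>t. \<Phi> t $ s) u - b s * (1 / G u * deriv G u)) (at u)"
        unfolding R_def
        by (intro DERIV_diff DERIV_cmult DERIV_chain2[OF DERIV_ln_divide]
            C1_upto_one_DERIV[OF _ q(1)] \<Phi>_C1 G_C1 q)
      then show "(R has_real_derivative 0) (at u)" by (simp only: e)
    qed (use lt in auto)
    then have "ln (\<Phi> t $ s) = b s * ln (G t)"
      using \<Phi>_at_1 G1 by (simp add: R_def)
    moreover have "\<Phi> t $ s = exp (ln (\<Phi> t $ s))" using xpos[of t] lt by simp
    ultimately have "\<Phi> t $ s = G t powr b s" using t(2) by (simp add: powr_def)
    moreover have "p 1 = p t"
    proof (rule DERIV_isconst2[OF lt continuous_on_subset[OF C1_upto_one_continuous[OF p_C1] sub]])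
      fix u assume u: "t < u" "u < 1"
      have q: "u \<in> {q0<..<1}" "0 < G u" using u t0 Gpos by auto
      show "(p has_real_derivative 0) (at u)"
        using C1_upto_one_DERIV[OF p_C1 q(1)] integrand_extremal(2)[OF q extremal_pointwise(3)[OF max q]]
        by simp
    qed (use lt in auto)
    ultimately show ?thesis using p1 by simp
  qed
  then show "\<Phi> t $ s = G t powr b s" "p t = 1" by auto
qed

lemma extremal_from_zero:
  assumes max: "alg_functional lam xi 0 p \<Phi> q0 = 2 * rate"
  shows "q0 = 0" "t \<in> {0..1} \<Longrightarrow> \<Phi> t $ s = G t powr b s" "t \<in> {0..1} \<Longrightarrow> p t = 1"
    and "t \<in> {0<..1} \<Longrightarrow> 0 < G t"
proof -
  have G1: "G 1 = 1" and G0: "G q0 = 0" by (rule extremal_pointwise[OF max])+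
  obtain t0 where t0: "t0 \<in> {q0..1}" "\<And>t. t \<in> {q0..1} \<Longrightarrow> t0 < t \<Longrightarrow> 0 < G t" "G t0 = 0"
    using zero_threshold G0 by metis
  have lt: "t0 < 1" using t0 G1 by (cases "t0 = 1") auto
  have sub: "{t0..1} \<subseteq> {q0..1}" using t0 by auto
  note cont = continuous_on_subset[OF C1_upto_one_continuous sub]
  have x0: "\<Phi> t0 $ s = 0" for s
  proof -
    have "\<Phi> t0 $ s = G t0 powr b s"
    proof (rule eq_on_left_closed[OF lt cont[OF \<Phi>_C1]])
      show "continuous_on {t0..1} (\<lambda>t. G t powr b s)"
        by (rule continuous_on_powr'[OF cont[OF G_C1] continuous_on_const])
          (use G_range sub b_pos[of s] in force)
      show "\<Phi> t $ s = G t powr b s" if "t \<in> {t0<..1}" for t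
        by (rule extremal_powr[OF max]) (use that t0 in auto)
    qed
    then show ?thesis using t0 by simp
  qed
  \<comment> \<open>All coordinates vanish at \<open>t0\<close>, so admissibility at time \<open>t0\<close> forces \<open>t0 = 0\<close>.\<close>
  have t00: "t0 = 0" using admissible[OF t0(1)] x0 by simp
  then show q00: "q0 = 0" using t0(1) q0 by auto
  show pos: "0 < G t" if "t \<in> {0<..1}" for t using t0(2)[of t] that t00 q00 by auto
  show "\<Phi> t $ s = G t powr b s" if t: "t \<in> {0..1}"
  proof (cases "t = 0")
    case True
    then show ?thesis using x0 t0 t00 by simp
  next
    case False
    then show ?thesis using extremal_powr(1)[OF max, of t] pos[of t] t q00 by auto
  qed
  have pp: "p t = 1" if "t \<in> {0<..1}" for t
    using extremal_powr(2)[OF max, of t] pos[of t] that q00 by auto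
  have "p 0 = 1"
    by (rule eq_on_left_closed[of 0 1 p "\<lambda>_. 1"])
      (use pp C1_upto_one_continuous[OF p_C1] q00 in auto)
  then show "p t = 1" if "t \<in> {0..1}"
    using pp[of t] that by (cases "t = 0") auto
qed

text \<open>Time is recovered from \<open>G\<close> by admissibility, \<open>t = (\<Sum>s. \<lambda>\<^sub>s G t powr b\<^sub>s)\<close>; hence \<open>G\<close> is injective
  and \<open>G'\<close> has no zero at interior times.\<close>

lemma extremal_time_change:
  assumes max: "alg_functional lam xi 0 p \<Phi> q0 = 2 * rate"
  shows "time_change 0 0 G"
proof -
  note ext = extremal_from_zero[OF max]
  have G1: "G 1 = 1" and G0: "G 0 = 0" using extremal_pointwise[OF max] ext(1) by auto
  have cont: "continuous_on {0..1} G" using C1_upto_one_continuous[OF G_C1] ext(1) by simp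
  have time: "(\<Sum>s\<in>UNIV. lam $ s * G t powr b s) = t" if "t \<in> {0..1}" for t
    using admissible[of t] ext(1) ext(2)[OF that] that by simp
  have strict: "strict_mono_on {0..1} G"
  proof (rule strict_mono_onI)
    fix t u :: real assume *: "t \<in> {0..1}" "u \<in> {0..1}" "t < u"
    have "G t \<noteq> G u"
    proof
      assume eq: "G t = G u"
      have "t = (\<Sum>s\<in>UNIV. lam $ s * G u powr b s)"
        using time[OF *(1)] unfolding eq by (rule sym)
      also have "\<dots> = u" by (rule time[OF *(2)])
      finally show False using *(3) by simp
    qed
    moreover have "G t \<le> G u" using mono_onD[OF G_mono, of t u] * ext(1) by simp
    ultimately show "G t < G u" by simp
  qed
  have image: "G ` {0..1} = {0..1}"
  proof
    show "G ` {0..1} \<subseteq> {0..1}" using G_range ext(1) by auto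
    show "{0..1} \<subseteq> G ` {0..1}"
    proof
      fix y :: real assume "y \<in> {0..1}"
      then show "y \<in> G ` {0..1}" using IVT'[of G 0 y 1] cont G0 G1 by auto
    qed
  qed
  have "0 < deriv G t" if t: "t \<in> {0<..<1}" for t
  proof -
    have q: "t \<in> {q0<..<1}" "0 < G t" using t ext(1) ext(4)[of t] by auto
    have "deriv G t \<noteq> 0"
    proof
      assume g: "deriv G t = 0"
      have x': "deriv (\<lambda>t. \<Phi> t $ s) t = 0" for s
        using integrand_extremal(1)[OF q extremal_pointwise(3)[OF max q], of s]
          positive_point(2)[OF q, of s] q(2) g by (simp add: v_def)
      have "((\<lambda>u. \<Sum>s\<in>UNIV. lam $ s * \<Phi> u $ s) has_real_derivative
          (\<Sum>s\<in>UNIV. lam $ s * deriv (\<lambda>t. \<Phi> t $ s) t)) (at t)"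
        by (intro DERIV_sum DERIV_cmult C1_upto_one_DERIV[OF \<Phi>_C1 q(1)])
      moreover have "eventually (\<lambda>u. u \<in> {q0<..<1}) (nhds t)"
        by (rule eventually_nhds_in_open) (use q in auto)
      then have "eventually (\<lambda>u. (\<Sum>s\<in>UNIV. lam $ s * \<Phi> u $ s) = u) (nhds t)"
        by eventually_elim (simp add: admissible)
      then have "((\<lambda>u. \<Sum>s\<in>UNIV. lam $ s * \<Phi> u $ s) has_real_derivative 0) (at t)
          \<longleftrightarrow> ((\<lambda>u. u) has_real_derivative 0) (at t)"
        by (intro DERIV_cong_ev refl)
      ultimately have "((\<lambda>u. u) has_real_derivative 0) (at t)"
        by (simp add: x')
      then show False using DERIV_unique[OF _ DERIV_ident] by force
    qed
    then show ?thesis using deriv_nonneg_of_mono[OF G_mono G_C1 q(1)] by simp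
  qed
  moreover have "continuous_on {0<..<1} (deriv G)"
    using C1_upto_one_continuous_deriv[OF G_C1] ext(1) by simp
  ultimately show ?thesis
    unfolding time_change_def using strict image C1_upto_one_DERIV[OF G_C1] ext(1) by auto
qed

end

section \<open>Changes of time\<close>

lemma time_change_bij:
  assumes "time_change u v \<alpha>"
  shows "t \<in> {u..1} \<Longrightarrow> \<alpha> t \<in> {v..1}"
    and "y \<in> {v..1} \<Longrightarrow> \<exists>t\<in>{u..1}. \<alpha> t = y"
    and "s \<in> {u..1} \<Longrightarrow> t \<in> {u..1} \<Longrightarrow> s < t \<Longrightarrow> \<alpha> s < \<alpha> t"
    and "s \<in> {u..1} \<Longrightarrow> t \<in> {u..1} \<Longrightarrow> s \<le> t \<Longrightarrow> \<alpha> s \<le> \<alpha> t"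
proof -
  have *: "\<alpha> ` {u..1} = {v..1}" "strict_mono_on {u..1} \<alpha>"
    using assms by (auto simp: time_change_def)
  show "t \<in> {u..1} \<Longrightarrow> \<alpha> t \<in> {v..1}" using *(1) by blast
  show "y \<in> {v..1} \<Longrightarrow> \<exists>t\<in>{u..1}. \<alpha> t = y" using *(1) by force
  show lt: "s \<in> {u..1} \<Longrightarrow> t \<in> {u..1} \<Longrightarrow> s < t \<Longrightarrow> \<alpha> s < \<alpha> t"
    using *(2) by (rule strict_mono_onD)
  show "s \<in> {u..1} \<Longrightarrow> t \<in> {u..1} \<Longrightarrow> s \<le> t \<Longrightarrow> \<alpha> s \<le> \<alpha> t"
    using lt by (cases "s = t") auto
qed

text \<open>At the endpoints continuity has to come from monotonicity and surjectivity.\<close>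

lemma time_change_continuous:
  assumes "time_change u v \<alpha>"
  shows "continuous_on {u..1} \<alpha>"
  unfolding continuous_on_iff
proof (intro ballI allI impI)
  fix x and e :: real assume x: "x \<in> {u..1}" and e: "0 < e"
  note bij = time_change_bij[OF assms]
  have "\<exists>d>0. \<forall>t\<in>{u..1}. \<bar>t - x\<bar> < d \<longrightarrow> \<alpha> t < \<alpha> x + e"
  proof (cases "\<alpha> x + e / 2 \<le> 1")
    case True
    then obtain s where s: "s \<in> {u..1}" "\<alpha> s = \<alpha> x + e / 2"
      using bij(2)[of "\<alpha> x + e / 2"] bij(1)[OF x] e by auto
    have "x < s" using bij(4)[OF s(1) x] s(2) e by (rule_tac ccontr) auto
    then show ?thesis
      using bij(4)[OF _ s(1)] s(2) e by (intro exI[of _ "s - x"]) force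
  next
    case False
    then have "\<alpha> t < \<alpha> x + e" if "t \<in> {u..1}" for t
      using bij(1)[OF that] e by auto
    then show ?thesis by (intro exI[of _ 1]) auto
  qed
  then obtain d1 where d1: "d1 > 0" "\<And>t. t \<in> {u..1} \<Longrightarrow> \<bar>t - x\<bar> < d1 \<Longrightarrow> \<alpha> t < \<alpha> x + e" by blast
  have "\<exists>d>0. \<forall>t\<in>{u..1}. \<bar>t - x\<bar> < d \<longrightarrow> \<alpha> x - e < \<alpha> t"
  proof (cases "v \<le> \<alpha> x - e / 2")
    case True
    then obtain s where s: "s \<in> {u..1}" "\<alpha> s = \<alpha> x - e / 2"
      using bij(2)[of "\<alpha> x - e / 2"] bij(1)[OF x] e by auto
    have "s < x" using bij(4)[OF x s(1)] s(2) e by (rule_tac ccontr) auto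
    then show ?thesis
      using bij(4)[OF s(1)] s(2) e by (intro exI[of _ "x - s"]) force
  next
    case False
    then have "\<alpha> x - e < \<alpha> t" if "t \<in> {u..1}" for t
      using bij(1)[OF that] e by auto
    then show ?thesis by (intro exI[of _ 1]) auto
  qed
  then obtain d2 where d2: "d2 > 0" "\<And>t. t \<in> {u..1} \<Longrightarrow> \<bar>t - x\<bar> < d2 \<Longrightarrow> \<alpha> x - e < \<alpha> t" by blast
  show "\<exists>d>0. \<forall>t\<in>{u..1}. dist t x < d \<longrightarrow> dist (\<alpha> t) (\<alpha> x) < e"
    by (rule exI[of _ "min d1 d2"]) (use d1 d2 in \<open>force simp: dist_real_def abs_less_iff\<close>)
qed

lemma time_change_zero:
  assumes "time_change u 0 \<alpha>"
  shows "u < 1" "\<alpha> u = 0" "\<alpha> 1 = 1" "t \<in> {u<..<1} \<Longrightarrow> 0 < \<alpha> t"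
proof -
  note bij = time_change_bij[OF assms]
  obtain s0 where s0: "s0 \<in> {u..1}" "\<alpha> s0 = 0" using bij(2)[of 0] by auto
  obtain s1 where s1: "s1 \<in> {u..1}" "\<alpha> s1 = 1" using bij(2)[of 1] by auto
  have "s0 \<noteq> s1" using s0 s1 by auto
  then show u: "u < 1" using s0 s1 by auto
  show a0: "\<alpha> u = 0" using bij(4)[of u s0] bij(1)[of u] s0 by auto
  show "\<alpha> 1 = 1" using bij(4)[of s1 1] bij(1)[of 1] s1 by auto
  show "t \<in> {u<..<1} \<Longrightarrow> 0 < \<alpha> t" using bij(3)[of u t] a0 by auto
qed

lemma time_change_powr:
  assumes tc: "time_change u 0 \<alpha>" and c: "0 < c"
  shows "time_change u 0 (\<lambda>t. \<alpha> t powr c)"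
proof -
  note bij = time_change_bij[OF tc]
  note zero = time_change_zero[OF tc]
  obtain \<alpha>' where \<alpha>': "continuous_on {u<..<1} \<alpha>'"
    "\<And>t. t \<in> {u<..<1} \<Longrightarrow> 0 < \<alpha>' t \<and> (\<alpha> has_real_derivative \<alpha>' t) (at t)"
    using tc unfolding time_change_def by blast
  have "strict_mono_on {u..1} (\<lambda>t. \<alpha> t powr c)"
  proof (rule strict_mono_onI)
    fix s t assume "s \<in> {u..1}" "t \<in> {u..1}" "s < t"
    then show "\<alpha> s powr c < \<alpha> t powr c"
      using bij(1)[of s] bij(3)[of s t] c by (intro powr_less_mono2) auto
  qed
  moreover have "(\<lambda>t. \<alpha> t powr c) ` {u..1} = {0..1}"
  proof (intro equalityI subsetI)
    fix y assume "y \<in> (\<lambda>t. \<alpha> t powr c) ` {u..1}"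
    then show "y \<in> {0..1}" using bij(1) c by (auto intro!: powr_le1)
  next
    fix y :: real assume y: "y \<in> {0..1}"
    then have "y powr (1 / c) \<in> {0..1}" using c by (auto intro!: powr_le1)
    then obtain t where t: "t \<in> {u..1}" "\<alpha> t = y powr (1 / c)" using bij(2) by blast
    have "\<alpha> t powr c = y" using t(2) y c by (simp add: powr_powr)
    then show "y \<in> (\<lambda>t. \<alpha> t powr c) ` {u..1}" using t(1) by force
  qed
  moreover have "\<exists>\<beta>. continuous_on {u<..<1} \<beta> \<and>
      (\<forall>t\<in>{u<..<1}. 0 < \<beta> t \<and> ((\<lambda>t. \<alpha> t powr c) has_real_derivative \<beta> t) (at t))"
  proof (intro exI[of _ "\<lambda>t. c * \<alpha> t powr (c - 1) * \<alpha>' t"] conjI ballI)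
    have "continuous_on {u<..<1} \<alpha>"
      by (rule continuous_on_subset[OF time_change_continuous[OF tc]]) auto
    then show "continuous_on {u<..<1} (\<lambda>t. c * \<alpha> t powr (c - 1) * \<alpha>' t)"
      using zero(4) by (intro continuous_intros \<alpha>') force+
    fix t assume t: "t \<in> {u<..<1}"
    show "0 < c * \<alpha> t powr (c - 1) * \<alpha>' t" using c \<alpha>'(2)[OF t] zero(4)[OF t] by simp
    show "((\<lambda>t. \<alpha> t powr c) has_real_derivative c * \<alpha> t powr (c - 1) * \<alpha>' t) (at t)"
      by (rule DERIV_chain2[where f = "\<lambda>z. z powr c"])
        (use has_real_derivative_powr[OF zero(4)[OF t]] \<alpha>'(2)[OF t] in auto)
  qed
  ultimately show ?thesis unfolding time_change_def by blast
qed

lemma time_change_id: "time_change 0 0 (\<lambda>t. t)"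
  unfolding time_change_def
  by (intro conjI exI[of _ "\<lambda>_. 1"]) (auto intro!: strict_mono_onI)

section \<open>The value on a power law\<close>

context critical_exponents
begin

text \<open>Since \<open>(\<Sum>s. a\<^sub>s b\<^sub>s) = 1\<close>, the monomial is the identity along the power law.\<close>

lemma xi_power_law:
  assumes y: "0 < y" and x: "\<And>s. x $ s = y powr b s"
  shows "xi x = y" "cofactor s x = y powr (1 - b s)"
proof -
  have "xi x = (\<Prod>s\<in>UNIV. y powr (real (a s) * b s))"
    unfolding xi_def x using y by (simp add: powr_powr mult.commute flip: powr_realpow)
  also have "\<dots> = y powr 1" using y sum_ab by (simp add: powr_sum[symmetric])
  finally show xi: "xi x = y" using y by simp
  have "y powr b s * cofactor s x = y powr b s * y powr (1 - b s)"
    using xi_cofactor[of x s] y by (simp add: xi x flip: powr_add)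
  then show "cofactor s x = y powr (1 - b s)" using y by simp
qed

text \<open>Nothing is assumed about differentiability of the path at the endpoints or about admissibility.\<close>

lemma alg_functional_power_law:
  assumes tc: "time_change u 0 \<alpha>"
    and p: "\<And>t. t \<in> {u..1} \<Longrightarrow> p t = 1"
    and \<Phi>: "\<And>t s. t \<in> {u..1} \<Longrightarrow> \<Phi> t $ s = \<alpha> t powr b s"
  shows "alg_functional lam xi 0 p \<Phi> u = 2 * rate"
proof -
  note zero = time_change_zero[OF tc]
  obtain \<alpha>' where \<alpha>': "continuous_on {u<..<1} \<alpha>'"
    "\<And>t. t \<in> {u<..<1} \<Longrightarrow> 0 < \<alpha>' t"
    "\<And>t. t \<in> {u<..<1} \<Longrightarrow> (\<alpha> has_real_derivative \<alpha>' t) (at t)"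
    using tc unfolding time_change_def by blast
  have J: "((\<lambda>q. sqrt (deriv (\<lambda>t. \<Phi> t $ s) q * deriv (\<lambda>t. p t * xi_species lam xi s (\<Phi> t)) q))
      has_integral 2 * sqrt (real (a s) * (b s * (1 - b s)) / lam $ s)) {u..1}" (is "(?J has_integral ?I) _") for s
  proof -
    have "(?J has_integral ?I * sqrt (\<alpha> 1) - ?I * sqrt (\<alpha> u)) {u..1}"
    proof (rule fundamental_theorem_of_calculus_interior)
      show "continuous_on {u..1} (\<lambda>t. ?I * sqrt (\<alpha> t))"
        by (intro continuous_intros time_change_continuous[OF tc])
      fix q assume q: "q \<in> {u<..<1}"
      have pos: "0 < \<alpha> q" by (rule zero(4)[OF q])
      have ev: "eventually (\<lambda>t. t \<in> {u<..<1}) (nhds q)"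
        by (rule eventually_nhds_in_open) (use q in auto)
      have chain: "((\<lambda>t. \<alpha> t powr c) has_real_derivative c * \<alpha> q powr (c - 1) * \<alpha>' q) (at q)" for c
        by (rule DERIV_chain2[where f = "\<lambda>z. z powr c", OF has_real_derivative_powr[OF pos] \<alpha>'(3)[OF q]])
      have "deriv (\<lambda>t. \<Phi> t $ s) q = deriv (\<lambda>t. \<alpha> t powr b s) q"
        by (rule deriv_cong_ev[OF _ refl]) (use ev in eventually_elim, auto simp: \<Phi>)
      then have x': "deriv (\<lambda>t. \<Phi> t $ s) q = b s * \<alpha> q powr (b s - 1) * \<alpha>' q"
        using DERIV_imp_deriv[OF chain] by simp
      have "deriv (\<lambda>t. p t * xi_species lam xi s (\<Phi> t)) q =
          deriv (\<lambda>t. real (a s) / lam $ s * \<alpha> t powr (1 - b s)) q"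
        by (rule deriv_cong_ev[OF _ refl])
          (use ev in eventually_elim, auto simp: xi_species_eq p \<Phi> zero(4) xi_power_law(2))
      then have m': "deriv (\<lambda>t. p t * xi_species lam xi s (\<Phi> t)) q =
          real (a s) / lam $ s * ((1 - b s) * \<alpha> q powr (- b s) * \<alpha>' q)"
        using DERIV_imp_deriv[OF DERIV_cmult[OF chain[of "1 - b s"], of "real (a s) / lam $ s"]] by simp
      have "\<alpha> q powr (b s - 1) * \<alpha> q powr (- b s) = 1 / \<alpha> q"
        using pos by (simp only: powr_add[symmetric]) (simp add: powr_neg_one)
      moreover have "b s * P * d * (real (a s) / lam $ s * ((1 - b s) * Q * d))
          = real (a s) * (b s * (1 - b s)) / lam $ s * (d\<^sup>2 * (P * Q))" for P Q d
        by (simp add: power2_eq_square mult_ac)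
      ultimately have "deriv (\<lambda>t. \<Phi> t $ s) q * deriv (\<lambda>t. p t * xi_species lam xi s (\<Phi> t)) q
          = real (a s) * (b s * (1 - b s)) / lam $ s * ((\<alpha>' q)\<^sup>2 * (1 / \<alpha> q))"
        unfolding x' m' by (simp only:)
      then have Jq: "?J q = sqrt (real (a s) * (b s * (1 - b s)) / lam $ s) * (\<alpha>' q / sqrt (\<alpha> q))"
        using \<alpha>'(2)[OF q] by (simp add: real_sqrt_mult real_sqrt_divide)
      have "((\<lambda>t. ?I * sqrt (\<alpha> t)) has_real_derivative ?I * (inverse (sqrt (\<alpha> q)) / 2 * \<alpha>' q)) (at q)"
        by (intro DERIV_cmult DERIV_chain2[where f = sqrt] DERIV_real_sqrt pos \<alpha>'(3)[OF q])
      also have "?I * (inverse (sqrt (\<alpha> q)) / 2 * \<alpha>' q) = ?J q"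
        unfolding Jq by (simp add: inverse_eq_divide)
      finally show "((\<lambda>t. ?I * sqrt (\<alpha> t)) has_vector_derivative ?J q) (at q)"
        by (simp add: has_real_derivative_iff_has_vector_derivative)
    qed (use zero(1) in simp)
    then show ?thesis using zero by simp
  qed
  have "alg_functional lam xi 0 p \<Phi> u =
      (\<Sum>s\<in>UNIV. lam $ s * (2 * sqrt (real (a s) * (b s * (1 - b s)) / lam $ s)))"
    unfolding alg_functional_def by (simp add: integral_unique[OF J])
  also have "\<dots> = (\<Sum>s\<in>UNIV. 2 * sqrt (lam $ s * real (a s) * (b s * (1 - b s))))"
  proof (rule sum.cong)
    fix s
    define r where "r = sqrt (lam $ s)"
    have "lam $ s = r * r" "0 < r" using lam_pos[of s] by (simp_all add: r_def)
    then show "lam $ s * (2 * sqrt (real (a s) * (b s * (1 - b s)) / lam $ s)) =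
        2 * sqrt (lam $ s * real (a s) * (b s * (1 - b s)))"
      by (simp add: real_sqrt_mult real_sqrt_divide)
  qed simp
  finally show ?thesis by (simp add: rate_def sum_distrib_left)
qed

end

section \<open>An admissible power law\<close>

text \<open>At \<open>y = 0\<close> the case distinction matters, because \<open>0 powr 0 = 0\<close>.\<close>

lemma has_real_derivative_powr_Icc:
  fixes e :: real
  assumes e: "1 \<le> e" and y: "y \<in> {0..1}"
  shows "((\<lambda>y. y powr e) has_real_derivative (if e = 1 then 1 else e * y powr (e - 1))) (at y within {0..1})"
proof (cases "y = 0")
  case False
  then have "0 < y" using y by simp
  then show ?thesis
    by (intro DERIV_cong[OF has_field_derivative_at_within[OF has_real_derivative_powr]]) auto
next
  case True
  show ?thesis
  proof (cases "e = 1")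
    case True
    have "((\<lambda>y. y powr e) has_real_derivative 1) (at y within {0..1}) \<longleftrightarrow>
        ((\<lambda>y::real. y) has_real_derivative 1) (at y within {0..1})"
      by (rule has_field_derivative_cong_eventually)
        (use True \<open>y = 0\<close> in \<open>auto simp: eventually_at_filter\<close>)
    then show ?thesis using True by simp
  next
    case False
    have "continuous_on {0..1} (\<lambda>z::real. z powr (e - 1))"
      by (rule continuous_on_powr') (use e False in auto)
    then have "((\<lambda>z::real. z powr (e - 1)) \<longlongrightarrow> 0) (at 0 within {0..1})"
      using e False by (auto simp: continuous_on_def dest!: bspec[of _ _ 0])
    moreover have "eventually (\<lambda>z. z powr (e - 1) = (z powr e - 0 powr e) / (z - 0)) (at (0::real) within {0..1})"
      by (auto simp: eventually_at_filter powr_diff)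
    ultimately have "((\<lambda>z. (z powr e - 0 powr e) / (z - 0)) \<longlongrightarrow> 0) (at (0::real) within {0..1})"
      by (rule Lim_transform_eventually)
    then show ?thesis using \<open>y = 0\<close> False by (simp add: has_field_derivative_iff)
  qed
qed

lemma has_real_derivative_inverse_within:
  fixes f g :: "real \<Rightarrow> real"
  assumes f: "(f has_real_derivative d) (at y within S)" and d: "d \<noteq> 0" and y: "y \<in> S"
    and g: "continuous_on (f ` S) g" "\<And>z. z \<in> S \<Longrightarrow> g (f z) = z"
  shows "(g has_real_derivative 1 / d) (at (f y) within f ` S)"
  unfolding has_field_derivative_def
proof (rule has_derivative_inverse_within[OF _ _ y])
  show "(f has_derivative (*) d) (at y within S)"
    using f by (simp add: has_field_derivative_def)
  show "continuous (at (f y) within f ` S) g"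
    using g(1) y by (auto simp: continuous_on_eq_continuous_within)
  show "linear ((*) (1 / d))" by (rule linear_times)
  show "(*) (1 / d) \<circ> (*) d = id" using d by (auto simp: fun_eq_iff)
qed (rule g(2))

context critical_exponents
begin

text \<open>A power law in the smallest exponent is a \<open>C\<^sup>1\<close> function of admissible time: in terms of
  \<open>y = q powr b\<^sub>m\<^sub>i\<^sub>n\<close> the coordinates are \<open>y powr e\<close> with \<open>e \<ge> 1\<close>, and the elapsed time is a
  \<open>C\<^sup>1\<close> function of \<open>y\<close> with positive derivative, even at \<open>y = 0\<close>.\<close>

lemma ex_feasible_power_law:
  obtains \<alpha> \<Phi> where "feasible lam (\<lambda>_. 1) \<Phi> 0" "time_change 0 0 \<alpha>"
    "\<And>t. t \<in> {0..1} \<Longrightarrow> \<Phi> t = (\<chi> s. \<alpha> t powr b s)"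
proof -
  define m where "m = Min (range b)"
  define e where "e s = b s / m" for s
  have "m \<in> range b" unfolding m_def by (rule Min_in) auto
  then obtain s0 where s0: "m = b s0" by auto
  have m: "0 < m" using b_pos s0 by simp
  have e1: "1 \<le> e s" for s using m Min_le[of "range b" "b s"] by (simp add: e_def m_def[symmetric])
  have es0: "e s0 = 1" using s0 m by (simp add: e_def)
  define D where "D s y = (if e s = 1 then 1 else e s * y powr (e s - 1))" for s and y :: real
  define K where "K y = (\<Sum>s\<in>UNIV. lam $ s * y powr e s)" for y
  define K' where "K' y = (\<Sum>s\<in>UNIV. lam $ s * D s y)" for y
  have D_cont: "continuous_on {0..1} (D s)" for s
  proof (cases "e s = 1")
    case False
    then have "continuous_on {0..1} (\<lambda>y::real. y powr (e s - 1))"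
      by (intro continuous_on_powr') (use e1[of s] in auto)
    then show ?thesis using False by (auto simp: D_def[abs_def] intro: continuous_intros)
  qed (simp add: D_def[abs_def])
  have D_nonneg: "0 \<le> D s y" for s y using e1[of s] by (simp add: D_def)
  have D: "((\<lambda>y. y powr e s) has_real_derivative D s y) (at y within {0..1})" if "y \<in> {0..1}" for s y
    unfolding D_def by (rule has_real_derivative_powr_Icc[OF e1 that])
  have K: "(K has_real_derivative K' y) (at y within {0..1})" if "y \<in> {0..1}" for y
    unfolding K_def[abs_def] K'_def by (intro DERIV_sum DERIV_cmult D that)
  have K'_cont: "continuous_on {0..1} K'"
    unfolding K'_def[abs_def] by (intro continuous_intros D_cont)
  have K'_pos: "0 < K' y" for y
  proof -
    \<comment> \<open>The species with the smallest exponent has \<open>e s0 = 1\<close>, so its term never vanishes.\<close>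
    have "lam $ s0 * D s0 y \<le> K' y"
      unfolding K'_def by (rule member_le_sum) (use D_nonneg less_imp_le[OF lam_pos] in auto)
    then show ?thesis using lam_pos[of s0] es0 by (simp add: D_def)
  qed
  have K'_neq: "K' y \<noteq> 0" for y using K'_pos[of y] by simp
  have K_cont: "continuous_on {0..1} K" using K by (rule DERIV_continuous_on)
  have K_less: "K y < K z" if "0 \<le> y" "y < z" for y z
    unfolding K_def
    by (rule sum_strict_mono) (use that lam_pos e1 in \<open>auto intro!: mult_strict_left_mono powr_less_mono2 intro: less_le_trans[OF zero_less_one]\<close>)
  have K_le: "K y \<le> K z" if "0 \<le> y" "y \<le> z" for y z
    using K_less[of y z] that by (cases "y = z") auto
  have K01: "K 0 = 0" "K 1 = 1" using e1 lam_sum by (auto simp: K_def)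
  have inj: "inj_on K {0..1}"
  proof (rule inj_onI)
    fix y z assume "y \<in> {0..1}" "z \<in> {0..1}" "K y = K z"
    then show "y = z" using K_less[of y z] K_less[of z y] by (cases y z rule: linorder_cases) auto
  qed
  have image: "K ` {0..1} = {0..1}"
  proof (intro equalityI subsetI)
    fix t assume "t \<in> K ` {0..1}"
    then show "t \<in> {0..1}" using K_le[of 0] K_le[of _ 1] K01 by fastforce
  next
    fix t :: real assume "t \<in> {0..1}"
    then show "t \<in> K ` {0..1}" using IVT'[of K 0 t 1] K_cont K01 by auto
  qed
  define Y where "Y = the_inv_into {0..1} K"
  have YK: "Y (K y) = y" if "y \<in> {0..1}" for y
    unfolding Y_def by (rule the_inv_into_f_f[OF inj that])
  have KY: "K (Y t) = t" if "t \<in> {0..1}" for t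
    unfolding Y_def by (rule f_the_inv_into_f[OF inj]) (use image that in simp)
  have Y01: "Y t \<in> {0..1}" if "t \<in> {0..1}" for t
  proof -
    have "t \<in> K ` {0..1}" using that by (simp only: image)
    then obtain y where "y \<in> {0..1}" "t = K y" by blast
    then show ?thesis using YK by simp
  qed
  have Y_cont: "continuous_on {0..1} Y"
    using continuous_on_inv_into[OF K_cont compact_Icc inj] image by (simp add: Y_def)
  have Y: "(Y has_real_derivative 1 / K' (Y t)) (at t within {0..1})" if "t \<in> {0..1}" for t
  proof -
    have "(Y has_real_derivative 1 / K' (Y t)) (at (K (Y t)) within K ` {0..1})"
      by (rule has_real_derivative_inverse_within[OF K[OF Y01[OF that]]])
        (use K'_pos[of "Y t"] Y01[OF that] YK Y_cont image in auto)
    then show ?thesis by (simp add: KY[OF that] image)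
  qed
  have Y_less: "Y t < Y u" if "t \<in> {0..1}" "u \<in> {0..1}" "t < u" for t u
  proof (rule ccontr)
    assume "\<not> Y t < Y u"
    then have "K (Y u) \<le> K (Y t)" using Y01[OF that(2)] by (intro K_le) auto
    then show False using KY that by simp
  qed
  have Y_le: "Y t \<le> Y u" if "t \<in> {0..1}" "u \<in> {0..1}" "t \<le> u" for t u
    using Y_less[of t u] that by (cases "t = u") auto
  have K'Y_cont: "continuous_on {0..1} (\<lambda>t. K' (Y t))"
    by (rule continuous_on_compose2[OF K'_cont Y_cont]) (use Y01 in auto)
  define \<Phi> where "\<Phi> t = (\<chi> s. Y t powr e s)" for t
  have \<Phi>_C1: "C1_upto_one 0 (\<lambda>t. \<Phi> t $ s)" for s
    unfolding C1_upto_one_def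
  proof (intro exI[of _ "\<lambda>t. D s (Y t) * (1 / K' (Y t))"] conjI ballI)
    have "continuous_on {0..1} (\<lambda>t. D s (Y t))"
      by (rule continuous_on_compose2[OF D_cont Y_cont]) (use Y01 in auto)
    then show "continuous_on {0..1} (\<lambda>t. D s (Y t) * (1 / K' (Y t)))"
      by (intro continuous_intros K'Y_cont ballI K'_neq)
    fix t :: real assume t: "t \<in> {0..1}"
    have "((\<lambda>y. y powr e s) has_real_derivative D s (Y t)) (at (Y t) within Y ` {0..1})"
      by (rule DERIV_subset[OF D[OF Y01[OF t]]]) (use Y01 in auto)
    from DERIV_image_chain[OF this Y[OF t]]
    show "((\<lambda>t. \<Phi> t $ s) has_real_derivative D s (Y t) * (1 / K' (Y t))) (at t within {0..1})"
      by (simp add: \<Phi>_def o_def)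
  qed
  have "(\<lambda>t. \<Phi> t $ s) \<in> incr_paths 0" for s
    unfolding incr_paths_iff
  proof (intro conjI \<Phi>_C1 mono_onI)
    show "(\<lambda>t. \<Phi> t $ s) ` {0..1} \<subseteq> {0..1}"
      using Y01 e1[of s] by (auto simp: \<Phi>_def intro!: powr_le1)
    fix t u :: real assume "t \<in> {0..1}" "u \<in> {0..1}" "t \<le> u"
    then show "\<Phi> t $ s \<le> \<Phi> u $ s"
      using Y_le[of t u] Y01[of t] e1[of s] by (auto simp: \<Phi>_def intro!: powr_mono2)
  qed
  moreover have "(\<Sum>s\<in>UNIV. lam $ s * \<Phi> t $ s) = t" if "t \<in> {0..1}" for t
    using KY[OF that] by (simp add: \<Phi>_def K_def)
  moreover have "(\<lambda>_. 1) \<in> incr_paths 0"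
    by (auto simp: incr_paths_iff C1_upto_one_const intro: mono_onI)
  ultimately have feas: "feasible lam (\<lambda>_. 1) \<Phi> 0"
    by (simp add: feasible_def Adm_def)
  have "time_change 0 0 Y"
    unfolding time_change_def
  proof (intro conjI exI[of _ "\<lambda>t. 1 / K' (Y t)"] ballI)
    show "strict_mono_on {0..1} Y" by (rule strict_mono_onI) (rule Y_less)
    show "Y ` {0..1} = {0..1}"
    proof (intro equalityI subsetI)
      fix y :: real assume y: "y \<in> {0..1}"
      then have "K y \<in> K ` {0..1}" by (rule imageI)
      then have "K y \<in> {0..1}" by (simp only: image)
      then have "Y (K y) \<in> Y ` {0..1}" by (rule imageI)
      then show "y \<in> Y ` {0..1}" by (simp only: YK[OF y])
    qed (use Y01 in blast)
    show "continuous_on {0<..<1} (\<lambda>t. 1 / K' (Y t))"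
      by (intro continuous_intros continuous_on_subset[OF K'Y_cont]) (auto simp: K'_neq)
    fix t :: real assume t: "t \<in> {0<..<1}"
    show "0 < 1 / K' (Y t)" using K'_pos by simp
    show "(Y has_real_derivative 1 / K' (Y t)) (at t)"
      using Y[of t] t at_within_Icc_at[of 0 t 1] by auto
  qed
  then have tc: "time_change 0 0 (\<lambda>t. Y t powr (1 / m))"
    by (rule time_change_powr) (use m in simp)
  show thesis
    by (rule that[OF feas tc]) (simp add: \<Phi>_def e_def powr_powr)
qed

section \<open>The supremum and its maximizers\<close>

lemma ALG_eq: "ALG lam xi 0 = ereal (2 * rate)"
proof (rule antisym)
  show "ALG lam xi 0 \<le> ereal (2 * rate)"
    unfolding ALG_def
  proof (intro SUP_least)
    fix q0 p \<Phi> assume "q0 \<in> {0..1}" "p \<in> incr_paths q0" "\<Phi> \<in> Adm lam q0"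
    then interpret feasible_path lam a b mu p \<Phi> q0
      by unfold_locales (simp add: feasible_def)
    show "ereal (alg_functional lam xi 0 p \<Phi> q0) \<le> ereal (2 * rate)"
      using alg_functional_le_rate by simp
  qed
  obtain \<alpha> \<Phi> where f: "feasible lam (\<lambda>_. 1) \<Phi> 0" and tc: "time_change 0 0 \<alpha>"
    and \<Phi>: "\<And>t. t \<in> {0..1} \<Longrightarrow> \<Phi> t = (\<chi> s. \<alpha> t powr b s)"
    by (rule ex_feasible_power_law) blast
  have "alg_functional lam xi 0 (\<lambda>_. 1) \<Phi> 0 = 2 * rate"
    by (rule alg_functional_power_law[OF tc]) (simp_all add: \<Phi>)
  moreover have "ereal (alg_functional lam xi 0 (\<lambda>_. 1) \<Phi> 0) \<le> ALG lam xi 0"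
    unfolding ALG_def using f
    by (intro SUP_upper2[of 0] SUP_upper2[of "\<lambda>_. 1"] SUP_upper2[of \<Phi>]) (auto simp: feasible_def)
  ultimately show "ereal (2 * rate) \<le> ALG lam xi 0" by simp
qed

lemma maximizer_iff:
  "maximizer lam xi 0 p \<Phi> q0 \<longleftrightarrow> feasible lam p \<Phi> q0 \<and>
     (\<exists>\<alpha>. time_change q0 0 \<alpha> \<and> (\<forall>t\<in>{q0..1}. p t = 1 \<and> \<Phi> t = (\<chi> s. \<alpha> t powr b s)))"
  (is "_ \<longleftrightarrow> _ \<and> ?P")
proof (cases "feasible lam p \<Phi> q0")
  case True
  then interpret feasible_path lam a b mu p \<Phi> q0 by unfold_locales
  have "alg_functional lam xi 0 p \<Phi> q0 = 2 * rate \<longleftrightarrow> ?P"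
  proof
    assume max: "alg_functional lam xi 0 p \<Phi> q0 = 2 * rate"
    have "time_change q0 0 G" "\<forall>t\<in>{q0..1}. p t = 1 \<and> \<Phi> t = (\<chi> s. G t powr b s)"
      using extremal_time_change[OF max] extremal_from_zero(1-3)[OF max] by (auto simp: vec_eq_iff)
    then show ?P by blast
  next
    assume ?P
    then obtain \<alpha> where "time_change q0 0 \<alpha>"
      "\<forall>t\<in>{q0..1}. p t = 1 \<and> \<Phi> t = (\<chi> s. \<alpha> t powr b s)" by blast
    then show "alg_functional lam xi 0 p \<Phi> q0 = 2 * rate"
      by (intro alg_functional_power_law) auto
  qed
  then show ?thesis using True by (simp add: maximizer_def ALG_eq)
qed (simp add: maximizer_def)

text \<open>The constant \<open>c\<close> only rescales the exponents, which is itself a change of time. The bilinear case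
  needs \<open>c = 2\<close>, as its maximizer \<open>(q, q)\<close> is not parametrized by the value of the monomial.\<close>

lemma unique_maximizer_power_law:
  assumes c: "0 < c" and \<Psi>: "\<And>q. q \<in> {0..1} \<Longrightarrow> \<Psi> q = (\<chi> s. q powr (c * b s))"
  shows "unique_maximizer_upto_reparam lam xi 0 (\<lambda>q. 1) \<Psi> 0"
  unfolding unique_maximizer_upto_reparam_def
proof (intro conjI allI)
  have "alg_functional lam xi 0 (\<lambda>q. 1) \<Psi> 0 = 2 * rate"
    by (rule alg_functional_power_law[OF time_change_powr[OF time_change_id c]])
      (simp_all add: \<Psi> powr_powr)
  then show "ereal (alg_functional lam xi 0 (\<lambda>q. 1) \<Psi> 0) = ALG lam xi 0"
    by (simp add: ALG_eq)
  obtain \<alpha> \<Phi> where "feasible lam (\<lambda>_. 1) \<Phi> 0" "time_change 0 0 \<alpha>"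
    "\<And>t. t \<in> {0..1} \<Longrightarrow> \<Phi> t = (\<chi> s. \<alpha> t powr b s)"
    by (rule ex_feasible_power_law) blast
  then have "maximizer lam xi 0 (\<lambda>_. 1) \<Phi> 0" unfolding maximizer_iff by auto
  then show "\<exists>p' \<Phi>' q0'. maximizer lam xi 0 p' \<Phi>' q0'" by blast
  fix p' :: "real \<Rightarrow> real" and \<Phi>' :: "real \<Rightarrow> real ^ 's" and q0' :: real
  have "(\<exists>\<alpha>. time_change q0' 0 \<alpha> \<and> (\<forall>t\<in>{q0'..1}. p' t = 1 \<and> \<Phi>' t = (\<chi> s. \<alpha> t powr b s)))
      \<longleftrightarrow> reparametrization (\<lambda>q. 1) \<Psi> 0 p' \<Phi>' q0'"
    unfolding reparametrization_def
  proof (intro iffI; elim exE conjE)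
    fix \<alpha> assume tc: "time_change q0' 0 \<alpha>"
      and *: "\<forall>t\<in>{q0'..1}. p' t = 1 \<and> \<Phi>' t = (\<chi> s. \<alpha> t powr b s)"
    have tc': "time_change q0' 0 (\<lambda>t. \<alpha> t powr (1 / c))" by (rule time_change_powr[OF tc]) (use c in simp)
    have "\<Phi>' t = \<Psi> (\<alpha> t powr (1 / c))" if "t \<in> {q0'..1}" for t
      using * that \<Psi>[OF time_change_bij(1)[OF tc' that]] c by (simp add: powr_powr)
    then show "\<exists>\<alpha>. time_change q0' 0 \<alpha> \<and> (\<forall>t\<in>{q0'..1}. p' t = 1 \<and> \<Phi>' t = \<Psi> (\<alpha> t))"
      using tc' * by blast
  next
    fix \<alpha> assume tc: "time_change q0' 0 \<alpha>"
      and *: "\<forall>t\<in>{q0'..1}. p' t = 1 \<and> \<Phi>' t = \<Psi> (\<alpha> t)"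
    have "\<Phi>' t = (\<chi> s. (\<alpha> t powr c) powr b s)" if "t \<in> {q0'..1}" for t
      using * that \<Psi>[OF time_change_bij(1)[OF tc that]] by (simp add: powr_powr)
    then show "\<exists>\<alpha>. time_change q0' 0 \<alpha> \<and> (\<forall>t\<in>{q0'..1}. p' t = 1 \<and> \<Phi>' t = (\<chi> s. \<alpha> t powr b s))"
      using time_change_powr[OF tc c] * by blast
  qed
  then show "maximizer lam xi 0 p' \<Phi>' q0' \<longleftrightarrow>
      feasible lam p' \<Phi>' q0' \<and> reparametrization (\<lambda>q. 1) \<Psi> 0 p' \<Phi>' q0'"
    unfolding maximizer_iff by simp
qed

end

section \<open>The exponents\<close>

lemma b_exponent_identities:
  assumes l: "0 < lam $ s" and a: "0 < a s" and L: "0 < L"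
  shows "0 < b_exponent lam a L s" "b_exponent lam a L s < 1"
    and "sqrt (b_exponent lam a L s * (1 - b_exponent lam a L s)) =
      sqrt (L * lam $ s) / (2 * sqrt (real (a s) + L * lam $ s))"
    and "1 - 2 * b_exponent lam a L s = sqrt (real (a s)) / sqrt (real (a s) + L * lam $ s)"
proof -
  define d where "d = real (a s) + L * lam $ s"
  define r where "r = sqrt (real (a s) / d)"
  have Ll: "0 < L * lam $ s" using l L by simp
  then have d: "0 < d" "real (a s) < d" using a by (auto simp: d_def)
  have b: "b_exponent lam a L s = (1 - r) / 2" by (simp add: b_exponent_def r_def d_def)
  have r: "0 < r" "r < 1" using d a by (auto simp: r_def)
  then show "0 < b_exponent lam a L s" "b_exponent lam a L s < 1" by (auto simp: b)
  show "1 - 2 * b_exponent lam a L s = sqrt (real (a s)) / sqrt (real (a s) + L * lam $ s)"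
  proof -
    have "1 - 2 * b_exponent lam a L s = r" by (simp add: b field_simps)
    then show ?thesis by (simp add: r_def real_sqrt_divide d_def)
  qed
  have "r\<^sup>2 = real (a s) / d" using d by (simp add: r_def)
  then have "(1 - r) / 2 * (1 - (1 - r) / 2) = L * lam $ s / (4 * d)"
    using d by (simp add: field_simps power2_eq_square) (simp add: d_def algebra_simps)
  then show "sqrt (b_exponent lam a L s * (1 - b_exponent lam a L s)) =
      sqrt (L * lam $ s) / (2 * sqrt (real (a s) + L * lam $ s))"
    unfolding b d_def[symmetric] by (simp only: real_sqrt_divide real_sqrt_mult real_sqrt_four)
qed

lemma critical_exponents_b_exponent:
  fixes lam :: "real ^ 's::finite" and a :: "'s \<Rightarrow> nat"
  assumes "\<And>s. 0 < lam $ s" "(\<Sum>s\<in>UNIV. lam $ s) = 1" "\<And>s. 0 < a s" "0 < L"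
    and "(\<Sum>s\<in>UNIV. real (a s) * b_exponent lam a L s) = 1"
  shows "critical_exponents lam a (b_exponent lam a L) (1 / sqrt L)"
proof
  fix s
  show "sqrt (lam $ s * real (a s)) * (1 - 2 * b_exponent lam a L s) =
      2 * (1 / sqrt L) * real (a s) * sqrt (b_exponent lam a L s * (1 - b_exponent lam a L s))"
    unfolding b_exponent_identities(3,4)[OF assms(1,3,4)]
    using assms(4) by (simp add: real_sqrt_mult)
qed (use assms b_exponent_identities[OF assms(1,3,4)] in auto)

text \<open>In degree two the multiplier is \<open>0\<close>.\<close>

lemma critical_exponents_half:
  fixes lam :: "real ^ 's::finite"
  assumes "\<And>s. 0 < lam $ s" "(\<Sum>s\<in>UNIV. lam $ s) = 1" "CARD('s) = 2"
  shows "critical_exponents lam (\<lambda>_. 1) (\<lambda>_. 1 / 2) 0"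
  by unfold_locales (use assms in auto)

text \<open>The sum of the \<open>a\<^sub>s b\<^sub>s\<close> increases with \<open>L\<close> from \<open>0\<close> to half the degree, hence meets \<open>1\<close> once
  when the degree is at least \<open>3\<close>.\<close>

lemma ex1_L:
  fixes lam :: "real ^ 's::finite" and a :: "'s \<Rightarrow> nat"
  assumes l: "\<And>s. 0 < lam $ s" and a: "\<And>s. 0 < a s" and deg: "3 \<le> (\<Sum>s\<in>UNIV. a s)"
  shows "\<exists>!L. 0 < L \<and> (\<Sum>s\<in>UNIV. real (a s) * b_exponent lam a L s) = 1"
proof -
  define f where "f L = (\<Sum>s\<in>UNIV. real (a s) * b_exponent lam a L s)" for L
  have den: "0 < real (a s) + L * lam $ s" if "0 \<le> L" for L s
    using l[of s] a[of s] that by (intro add_pos_nonneg) auto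
  have less: "f L < f M" if "0 \<le> L" "L < M" for L M
    unfolding f_def
  proof (rule sum_strict_mono)
    fix s
    have "real (a s) / (real (a s) + M * lam $ s) < real (a s) / (real (a s) + L * lam $ s)"
      using den[of L s] den[of M s] that l[of s] a[of s] by (intro divide_strict_left_mono) auto
    then show "real (a s) * b_exponent lam a L s < real (a s) * b_exponent lam a M s"
      using a[of s] by (simp add: b_exponent_def)
  qed auto
  have cont: "continuous_on {0..} f"
    unfolding f_def b_exponent_def
    by (intro continuous_intros) (use less_imp_neq[OF den, symmetric] in auto)
  have f0: "f 0 = 0" by (simp add: f_def b_exponent_def gr_implies_not0[OF a])
  have "(f \<longlongrightarrow> (\<Sum>s\<in>UNIV. real (a s) * ((1 - sqrt 0) / 2))) at_top"
    unfolding f_def b_exponent_def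
  proof (intro tendsto_intros)
    fix s
    have "filterlim (\<lambda>L. real (a s) + L * lam $ s) at_top at_top"
      by (intro filterlim_tendsto_add_at_top[OF tendsto_const] filterlim_at_top_mult_tendsto_pos[OF tendsto_const l filterlim_ident])
    then show "((\<lambda>L. real (a s) / (real (a s) + L * lam $ s)) \<longlongrightarrow> 0) at_top"
      by (intro real_tendsto_divide_at_top[OF tendsto_const])
  qed simp
  moreover have "1 < (\<Sum>s\<in>UNIV. real (a s) * ((1 - sqrt 0) / 2))"
    using deg by (simp flip: sum_divide_distrib of_nat_sum)
  ultimately have "eventually (\<lambda>L. 1 < f L) at_top" by (rule order_tendstoD(1))
  then obtain M where M: "0 < M" "1 < f M"
    using eventually_conj[OF _ eventually_gt_at_top[of 0]] eventually_happens'[OF trivial_limit_at_top_linorder]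
    by blast
  have "\<exists>L\<ge>0. L \<le> M \<and> f L = 1"
    by (rule IVT') (use f0 M in \<open>auto intro: continuous_on_subset[OF cont]\<close>)
  then obtain L where L: "0 \<le> L" "f L = 1" by blast
  have "0 < L" using L f0 by (cases "L = 0") auto
  moreover have "N = L" if "0 < N" "f N = 1" for N
    using less[of N L] less[of L N] L that by (cases N L rule: linorder_cases) auto
  ultimately show ?thesis unfolding f_def[symmetric] using L by blast
qed

theorem theorem4:
  fixes lam :: "real ^ 's::finite"
  assumes lam_pos: "\<And>s. 0 < lam $ s"
    and lam_sum: "(\<Sum>s\<in>UNIV. lam $ s) = 1"
  shows
    "(\<forall>(a :: 's \<Rightarrow> nat) (\<xi> :: real ^ 's \<Rightarrow> real).
        2 \<le> CARD('s) \<and> (\<forall>s. 0 < a s) \<and> 3 \<le> (\<Sum>s\<in>UNIV. a s) \<and>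
        \<xi> = (\<lambda>x. \<Prod>s\<in>UNIV. (x $ s) ^ a s) \<longrightarrow>
        (\<exists>!L. 0 < L \<and> (\<Sum>s\<in>UNIV. real (a s) * b_exponent lam a L s) = 1) \<and>
        (\<forall>L. 0 < L \<and> (\<Sum>s\<in>UNIV. real (a s) * b_exponent lam a L s) = 1 \<longrightarrow>
           ALG lam \<xi> 0 =
             ereal (\<Sum>s\<in>UNIV. lam $ s * sqrt (L * real (a s)) / sqrt (real (a s) + L * lam $ s)) \<and>
           unique_maximizer_upto_reparam lam \<xi> 0
             (\<lambda>q. 1) (\<lambda>q. \<chi> s. q powr b_exponent lam a L s) 0)) \<and>
     (\<forall>(s1 :: 's) (s2 :: 's) (\<xi> :: real ^ 's \<Rightarrow> real).
        s1 \<noteq> s2 \<and> UNIV = {s1, s2} \<and> \<xi> = (\<lambda>x. x $ s1 * x $ s2) \<longrightarrow>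
        ALG lam \<xi> 0 = ereal (sqrt (lam $ s1) + sqrt (lam $ s2)) \<and>
        unique_maximizer_upto_reparam lam \<xi> 0 (\<lambda>q. 1) (\<lambda>q. \<chi> s. q) 0)"
proof (intro conjI allI impI; (elim conjE)?)
  fix a :: "'s \<Rightarrow> nat"
  assume a: "\<forall>s. 0 < a s" and deg: "3 \<le> (\<Sum>s\<in>UNIV. a s)"
  show "\<exists>!L. 0 < L \<and> (\<Sum>s\<in>UNIV. real (a s) * b_exponent lam a L s) = 1"
    using a by (intro ex1_L lam_pos deg) simp
next
  fix a :: "'s \<Rightarrow> nat" and \<xi> :: "real ^ 's \<Rightarrow> real" and L :: real
  assume a: "\<forall>s. 0 < a s" and L: "0 < L" "(\<Sum>s\<in>UNIV. real (a s) * b_exponent lam a L s) = 1"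
    and xi: "\<xi> = (\<lambda>x. \<Prod>s\<in>UNIV. (x $ s) ^ a s)"
  interpret critical_exponents lam a "b_exponent lam a L" "1 / sqrt L"
    by (rule critical_exponents_b_exponent) (use lam_pos lam_sum a L in auto)
  have \<xi>: "\<xi> = critical_exponents.xi a" by (simp add: xi xi_def[abs_def])
  have "2 * rate = (\<Sum>s\<in>UNIV. lam $ s * sqrt (L * real (a s)) / sqrt (real (a s) + L * lam $ s))"
    unfolding rate_def sum_distrib_left
  proof (rule sum.cong)
    fix s
    have "2 * sqrt (lam $ s * real (a s) * (b_exponent lam a L s * (1 - b_exponent lam a L s))) =
        sqrt (lam $ s * real (a s)) * sqrt (L * lam $ s) / sqrt (real (a s) + L * lam $ s)"
      by (simp add: real_sqrt_mult[of "lam $ s * real (a s)"] b_exponent_identities(3)[OF lam_pos a_pos L(1)])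
    also have "sqrt (lam $ s * real (a s)) * sqrt (L * lam $ s) = lam $ s * sqrt (L * real (a s))"
      using lam_pos[of s] by (simp add: real_sqrt_mult)
    finally show "2 * sqrt (lam $ s * real (a s) * (b_exponent lam a L s * (1 - b_exponent lam a L s))) =
        lam $ s * sqrt (L * real (a s)) / sqrt (real (a s) + L * lam $ s)" .
  qed simp
  then show "ALG lam \<xi> 0 =
      ereal (\<Sum>s\<in>UNIV. lam $ s * sqrt (L * real (a s)) / sqrt (real (a s) + L * lam $ s))"
    using ALG_eq by (simp add: \<xi>)
  show "unique_maximizer_upto_reparam lam \<xi> 0 (\<lambda>q. 1) (\<lambda>q. \<chi> s. q powr b_exponent lam a L s) 0"
    unfolding \<xi> by (rule unique_maximizer_power_law[of 1]) auto
next
  fix s1 s2 :: 's and \<xi> :: "real ^ 's \<Rightarrow> real"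
  assume s: "s1 \<noteq> s2" "UNIV = {s1, s2}" and xi: "\<xi> = (\<lambda>x. x $ s1 * x $ s2)"
  have card: "CARD('s) = 2" unfolding s(2) using s(1) by simp
  interpret critical_exponents lam "\<lambda>_. 1" "\<lambda>_. 1 / 2" 0
    by (rule critical_exponents_half) (use lam_pos lam_sum card in auto)
  have \<xi>: "\<xi> = critical_exponents.xi (\<lambda>_. 1)"
  proof
    fix x show "\<xi> x = critical_exponents.xi (\<lambda>_. 1) x"
      unfolding xi xi_def s(2) using s(1) by simp
  qed
  have "2 * rate = (\<Sum>s\<in>UNIV. sqrt (lam $ s))"
    unfolding rate_def sum_distrib_left by (simp add: real_sqrt_divide real_sqrt_mult)
  also have "\<dots> = sqrt (lam $ s1) + sqrt (lam $ s2)" unfolding s(2) using s(1) by simp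
  finally have "2 * rate = sqrt (lam $ s1) + sqrt (lam $ s2)" .
  then show "ALG lam \<xi> 0 = ereal (sqrt (lam $ s1) + sqrt (lam $ s2))"
    using ALG_eq by (simp add: \<xi>)
  show "unique_maximizer_upto_reparam lam \<xi> 0 (\<lambda>q. 1) (\<lambda>q. \<chi> s. q) 0"
    unfolding \<xi> by (rule unique_maximizer_power_law[of 2]) auto
qed

end
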